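(* The assignments $(\_)^+:\mathbf{Inf}_{\mathrm{lin}}\to\mathbf{Psd}$ and $(\_)^-:\mathbf{Psd}\to\mathbf{Inf}_{\mathrm{lin}}$ described below are functors and define an equivalence between the categories $\mathbf{Inf}_{\mathrm{lin}}$ and $\mathbf{Psd}$.
   Context: A linear information system (LIS) is a triple $\mathcal{A}=(A,\mathrm{Con}_A,\vdash_A)$ with $A$ a set, $\mathrm{Con}_A\subseteq\mathcal{P}_{\mathrm f}(A)$ containing all singletons, $\vdash_A\subseteq A\times A$ reflexive and transitive, and such that if $a\in\mathrm{Con}_A$ and every $\beta\in b$ has some $\alpha\in a$ with $\alpha\vdash_A\beta$ then $b\in\mathrm{Con}_A$. A relation $R\subseteq A\times B$ is linear approximable if (AR1) whenever $a\in\mathrm{Con}_A$ and every $\beta\in b$ has some $\alpha\in a$ with $(\alpha,\beta)\in R$, then $b\in\mathrm{Con}_B$; (AR2) $\alpha'\vdash_A\alpha\,R\,\beta\vdash_B\beta'$ implies $(\alpha',\beta')\in R$. $\mathbf{Inf}_{\mathrm{lin}}$: LISs and linear approximable relations, relational composition, identities $\vdash_A$. An element $p$ of a Scott domain $\mathcal{D}$ is prime if whenever $B$ is a finite upper-bounded subset of $D$ with $p\le\bigvee B$, there is $b\in B$ with $p\le b$; $\mathcal{D}$ is prime algebraic if every element is the least upper bound of the primes below it; $\mathrm{Pr}(\mathcal{D})$ denotes the set of primes. A linear function between prime algebraic Scott domains is a Scott-continuous function preserving all existing least upper bounds. $\mathbf{Psd}$ is the category of prime algebraic Scott domains and linear functions.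 A point of a LIS $\mathcal{A}$ is a subset $x\subseteq A$ such that every finite subset of $x$ is in $\mathrm{Con}_A$ and $x$ is upward closed under $\vdash_A$ ($\alpha\in x$, $\alpha\vdash_A\alpha'$ imply $\alpha'\in x$). Define: $\mathcal{A}^+$ = the set of points of $\mathcal{A}$ ordered by inclusion; for $R\in\mathbf{Inf}_{\mathrm{lin}}(\mathcal{A},\mathcal{B})$, $R^+(x)=\{\beta\in B:\exists\alpha\in x.\,(\alpha,\beta)\in R\}$; for $\mathcal{D}\in\mathbf{Psd}$, $\mathcal{D}^-=(\mathrm{Pr}(\mathcal{D}),\mathrm{Con},\vdash)$ where a finite $a$ is in $\mathrm{Con}$ iff it is upper bounded in $\mathcal{D}$, and $p\vdash p'$ iff $p'\le_\mathcal{D}p$; for $f\in\mathbf{Psd}(\mathcal{D},\mathcal{E})$, $f^-=\{(p,p')\in\mathrm{Pr}(\mathcal{D})\times\mathrm{Pr}(\mathcal{E}):p'\le_\mathcal{E} f(p)\}$.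
   Formalization: Primes are also required to be compact (with finite B alone the claim fails for ω+1, whose primes give ω+2); the empty poset is admitted as a Scott domain, to match the system with A and Con empty; objects are those small in an arbitrary fixed universe, with points coded as its elements. *)

theory Defs
  imports "HOL-Algebra.Order"
begin

section \<open>Categories, functors, equivalences\<close>

text \<open>Hom-sets need not be disjoint; composition \<open>Comp C X Y Z g f\<close> (first \<open>f\<close>, then \<open>g\<close>) and
  the action of a functor on arrows therefore receive the objects involved as arguments.\<close>

record ('o, 'm) cat =
  Obj :: "'o set"
  Hom :: "'o \<Rightarrow> 'o \<Rightarrow> 'm set"
  Ident :: "'o \<Rightarrow> 'm"
  Comp :: "'o \<Rightarrow> 'o \<Rightarrow> 'o \<Rightarrow> 'm \<Rightarrow> 'm \<Rightarrow> 'm"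

definition is_category :: "('o, 'm) cat \<Rightarrow> bool" where
  "is_category C \<longleftrightarrow>
     (\<forall>X\<in>Obj C. Ident C X \<in> Hom C X X) \<and>
     (\<forall>X\<in>Obj C. \<forall>Y\<in>Obj C. \<forall>Z\<in>Obj C. \<forall>f\<in>Hom C X Y. \<forall>g\<in>Hom C Y Z.
        Comp C X Y Z g f \<in> Hom C X Z) \<and>
     (\<forall>X\<in>Obj C. \<forall>Y\<in>Obj C. \<forall>f\<in>Hom C X Y.
        Comp C X X Y f (Ident C X) = f \<and> Comp C X Y Y (Ident C Y) f = f) \<and>
     (\<forall>W\<in>Obj C. \<forall>X\<in>Obj C. \<forall>Y\<in>Obj C. \<forall>Z\<in>Obj C.
        \<forall>f\<in>Hom C W X. \<forall>g\<in>Hom C X Y. \<forall>h\<in>Hom C Y Z.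
          Comp C W Y Z h (Comp C W X Y g f) = Comp C W X Z (Comp C X Y Z h g) f)"

record ('o, 'm, 'p, 'n) fctr =
  omap :: "'o \<Rightarrow> 'p"
  amap :: "'o \<Rightarrow> 'o \<Rightarrow> 'm \<Rightarrow> 'n"

definition is_functor ::
    "('o, 'm) cat \<Rightarrow> ('p, 'n) cat \<Rightarrow> ('o, 'm, 'p, 'n) fctr \<Rightarrow> bool" where
  "is_functor C D F \<longleftrightarrow> is_category C \<and> is_category D \<and>
     (\<forall>X\<in>Obj C. omap F X \<in> Obj D) \<and>
     (\<forall>X\<in>Obj C. \<forall>Y\<in>Obj C. \<forall>f\<in>Hom C X Y.
        amap F X Y f \<in> Hom D (omap F X) (omap F Y)) \<and>
     (\<forall>X\<in>Obj C. amap F X X (Ident C X) = Ident D (omap F X)) \<and>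
     (\<forall>X\<in>Obj C. \<forall>Y\<in>Obj C. \<forall>Z\<in>Obj C. \<forall>f\<in>Hom C X Y. \<forall>g\<in>Hom C Y Z.
        amap F X Z (Comp C X Y Z g f) =
          Comp D (omap F X) (omap F Y) (omap F Z) (amap F Y Z g) (amap F X Y f))"

definition id_functor :: "('o, 'm, 'o, 'm) fctr" where
  "id_functor = \<lparr>omap = (\<lambda>X. X), amap = (\<lambda>X Y f. f)\<rparr>"

definition comp_functor ::
    "('p, 'n, 'q, 'k) fctr \<Rightarrow> ('o, 'm, 'p, 'n) fctr \<Rightarrow> ('o, 'm, 'q, 'k) fctr" where
  "comp_functor G F =
     \<lparr>omap = (\<lambda>X. omap G (omap F X)),
      amap = (\<lambda>X Y f. amap G (omap F X) (omap F Y) (amap F X Y f))\<rparr>"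

definition is_iso :: "('o, 'm) cat \<Rightarrow> 'o \<Rightarrow> 'o \<Rightarrow> 'm \<Rightarrow> bool" where
  "is_iso C X Y f \<longleftrightarrow> f \<in> Hom C X Y \<and>
     (\<exists>g\<in>Hom C Y X. Comp C X Y X g f = Ident C X \<and> Comp C Y X Y f g = Ident C Y)"

definition natural_iso ::
    "('o, 'm) cat \<Rightarrow> ('p, 'n) cat \<Rightarrow> ('o, 'm, 'p, 'n) fctr \<Rightarrow> ('o, 'm, 'p, 'n) fctr \<Rightarrow>
     ('o \<Rightarrow> 'n) \<Rightarrow> bool" where
  "natural_iso C D F G \<eta> \<longleftrightarrow>
     (\<forall>X\<in>Obj C. is_iso D (omap F X) (omap G X) (\<eta> X)) \<and>
     (\<forall>X\<in>Obj C. \<forall>Y\<in>Obj C. \<forall>f\<in>Hom C X Y.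
        Comp D (omap F X) (omap F Y) (omap G Y) (\<eta> Y) (amap F X Y f) =
        Comp D (omap F X) (omap G X) (omap G Y) (amap G X Y f) (\<eta> X))"

definition cat_equivalence ::
    "('o, 'm) cat \<Rightarrow> ('p, 'n) cat \<Rightarrow> ('o, 'm, 'p, 'n) fctr \<Rightarrow> ('p, 'n, 'o, 'm) fctr \<Rightarrow> bool" where
  "cat_equivalence C D F G \<longleftrightarrow> is_functor C D F \<and> is_functor D C G \<and>
     (\<exists>\<eta>. natural_iso C C id_functor (comp_functor G F) \<eta>) \<and>
     (\<exists>\<epsilon>. natural_iso D D (comp_functor F G) id_functor \<epsilon>)"


section \<open>Linear information systems\<close>

record 'a lis =
  tokens :: "'a set"
  con :: "'a set set"
  ent :: "('a \<times> 'a) set"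

definition is_lis :: "'a lis \<Rightarrow> bool" where
  "is_lis A \<longleftrightarrow>
     con A \<subseteq> {a. finite a \<and> a \<subseteq> tokens A} \<and>
     (\<forall>\<alpha>\<in>tokens A. {\<alpha>} \<in> con A) \<and>
     ent A \<subseteq> tokens A \<times> tokens A \<and>
     (\<forall>\<alpha>\<in>tokens A. (\<alpha>, \<alpha>) \<in> ent A) \<and>
     trans (ent A) \<and>
     (\<forall>a\<in>con A. \<forall>b. finite b \<and> b \<subseteq> tokens A \<and> (\<forall>\<beta>\<in>b. \<exists>\<alpha>\<in>a. (\<alpha>, \<beta>) \<in> ent A) \<longrightarrow> b \<in> con A)"

definition linear_approximable :: "'a lis \<Rightarrow> 'b lis \<Rightarrow> ('a \<times> 'b) set \<Rightarrow> bool" where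
  "linear_approximable A B R \<longleftrightarrow>
     R \<subseteq> tokens A \<times> tokens B \<and>
     (\<forall>a\<in>con A. \<forall>b. finite b \<and> b \<subseteq> tokens B \<and> (\<forall>\<beta>\<in>b. \<exists>\<alpha>\<in>a. (\<alpha>, \<beta>) \<in> R) \<longrightarrow> b \<in> con B) \<and>
     (\<forall>\<alpha>' \<alpha> \<beta> \<beta>'. (\<alpha>', \<alpha>) \<in> ent A \<and> (\<alpha>, \<beta>) \<in> R \<and> (\<beta>, \<beta>') \<in> ent B \<longrightarrow> (\<alpha>', \<beta>') \<in> R)"

definition points :: "'a lis \<Rightarrow> 'a set set" where
  "points A = {x. x \<subseteq> tokens A \<and> (\<forall>a. finite a \<and> a \<subseteq> x \<longrightarrow> a \<in> con A) \<and>
                  (\<forall>\<alpha> \<alpha>'. \<alpha> \<in> x \<and> (\<alpha>, \<alpha>') \<in> ent A \<longrightarrow> \<alpha>' \<in> x)}"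

lemma points_nonempty_iff: "points A \<noteq> {} \<longleftrightarrow> {} \<in> con A"
proof
  assume "{} \<in> con A"
  then have "{} \<in> points A" by (simp add: points_def)
  then show "points A \<noteq> {}" by blast
qed (auto simp: points_def)

definition rel_plus :: "('a \<times> 'b) set \<Rightarrow> 'a set \<Rightarrow> 'b set" where
  "rel_plus R x = {\<beta>. \<exists>\<alpha>\<in>x. (\<alpha>, \<beta>) \<in> R}"


section \<open>Prime algebraic Scott domains\<close>

definition is_lub :: "'a gorder \<Rightarrow> 'a set \<Rightarrow> 'a \<Rightarrow> bool" where
  "is_lub D S s \<longleftrightarrow> least D s (Upper D S)"

definition directed :: "'a gorder \<Rightarrow> 'a set \<Rightarrow> bool" where
  "directed D S \<longleftrightarrow> S \<subseteq> carrier D \<and> S \<noteq> {} \<and>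
     (\<forall>x\<in>S. \<forall>y\<in>S. \<exists>z\<in>S. x \<sqsubseteq>\<^bsub>D\<^esub> z \<and> y \<sqsubseteq>\<^bsub>D\<^esub> z)"

definition compact_elements :: "'a gorder \<Rightarrow> 'a set" where
  "compact_elements D = {k \<in> carrier D.
     \<forall>S s. directed D S \<and> is_lub D S s \<and> k \<sqsubseteq>\<^bsub>D\<^esub> s \<longrightarrow> (\<exists>d\<in>S. k \<sqsubseteq>\<^bsub>D\<^esub> d)}"

text \<open>The bounded set \<open>{}\<close> gives every nonempty Scott domain a least element.  The empty poset is
  not excluded: it is the poset of points of the degenerate system without tokens and with
  \<open>{} \<notin> con A\<close>, which the axioms of \<open>is_lis\<close> admit.\<close>

definition scott_domain :: "'a gorder \<Rightarrow> bool" where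
  "scott_domain D \<longleftrightarrow> partial_order D \<and>
     (\<forall>S. directed D S \<longrightarrow> (\<exists>s. is_lub D S s)) \<and>
     (\<forall>S. S \<subseteq> carrier D \<and> Upper D S \<noteq> {} \<longrightarrow> (\<exists>s. is_lub D S s)) \<and>
     (\<forall>x\<in>carrier D. directed D {k \<in> compact_elements D. k \<sqsubseteq>\<^bsub>D\<^esub> x} \<and>
                      is_lub D {k \<in> compact_elements D. k \<sqsubseteq>\<^bsub>D\<^esub> x} x)"

text \<open>Primes are required to be compact, i.e. they are the complete primes.  Primality with respect to
  finite sets alone does not give this: the top element \<open>\<omega>\<close> of the chain \<open>\<omega> + 1\<close> lies below the join
  of a finite \<open>B\<close> only if it belongs to \<open>B\<close>.  With \<open>\<omega>\<close> as a token, the points of the system of primes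
  of \<open>\<omega> + 1\<close> would form the chain \<open>\<omega> + 2\<close>.\<close>

definition primes :: "'a gorder \<Rightarrow> 'a set" where
  "primes D = {p \<in> compact_elements D.
     \<forall>B s. finite B \<and> B \<subseteq> carrier D \<and> Upper D B \<noteq> {} \<and> is_lub D B s \<and> p \<sqsubseteq>\<^bsub>D\<^esub> s \<longrightarrow>
       (\<exists>b\<in>B. p \<sqsubseteq>\<^bsub>D\<^esub> b)}"

definition prime_algebraic :: "'a gorder \<Rightarrow> bool" where
  "prime_algebraic D \<longleftrightarrow> (\<forall>x\<in>carrier D. is_lub D {p \<in> primes D. p \<sqsubseteq>\<^bsub>D\<^esub> x} x)"

definition scott_continuous :: "'a gorder \<Rightarrow> 'b gorder \<Rightarrow> ('a \<Rightarrow> 'b) \<Rightarrow> bool" where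
  "scott_continuous D E f \<longleftrightarrow> f \<in> carrier D \<rightarrow> carrier E \<and> isotone D E f \<and>
     (\<forall>S s. directed D S \<and> is_lub D S s \<longrightarrow> is_lub E (f ` S) (f s))"

definition linear_function :: "'a gorder \<Rightarrow> 'b gorder \<Rightarrow> ('a \<Rightarrow> 'b) \<Rightarrow> bool" where
  "linear_function D E f \<longleftrightarrow> scott_continuous D E f \<and>
     (\<forall>S s. S \<subseteq> carrier D \<and> is_lub D S s \<longrightarrow> is_lub E (f ` S) (f s))"


section \<open>Size\<close>

text \<open>The points of a system over \<open>'u\<close> are sets over \<open>'u\<close>, so for both categories to live on a single
  type, sets of tokens must be elements of that type.  \<open>small\<close> singles out the sets over \<open>'u\<close> that are
  elements of the universe, and \<open>code x\<close> is the small set \<open>x\<close> regarded as an element.  In the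
  von Neumann universe \<open>code\<close> is the identity, and a prime algebraic domain has a set of primes iff
  it is a set.  Independently of any axiom, \<open>universe_exists\<close> below provides, for each infinite
  cardinal, a universe whose small sets are those of at most this cardinality.\<close>

definition universe :: "('u set \<Rightarrow> bool) \<Rightarrow> ('u set \<Rightarrow> 'u) \<Rightarrow> bool" where
  "universe small code \<longleftrightarrow>
     (\<forall>X Y. small X \<and> Y \<subseteq> X \<longrightarrow> small Y) \<and>
     (\<forall>X f. small X \<longrightarrow> small (f ` X)) \<and>
     inj_on code {X. small X}"

lemma universe_exists:
  assumes inf: "infinite (UNIV :: 'k set)"
  shows "\<exists>code. universe (\<lambda>X :: 'k set set. \<exists>f :: 'k set \<Rightarrow> 'k. inj_on f X) code"
proof -
  let ?sm = "\<lambda>X :: 'k set set. \<exists>f :: 'k set \<Rightarrow> 'k. inj_on f X"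
  have "(card_of ((UNIV :: 'k set) \<times> (UNIV :: 'k set)), card_of (UNIV :: 'k set)) \<in> ordLeq"
    using card_of_Times_same_infinite[OF inf] by (rule ordIso_imp_ordLeq)
  then obtain t :: "'k \<times> 'k \<Rightarrow> 'k" where t: "inj t"
    by (metis UNIV_Times_UNIV card_of_ordLeq)
  define u :: 'k where "u = undefined"
  have "UNIV \<noteq> {u}"
    using inf by (metis finite.emptyI finite.insertI)
  then obtain v where uv: "u \<noteq> v" by (metis UNIV_eq_I singleton_iff)
  define s :: "'k + 'k \<Rightarrow> 'k" where "s = case_sum (\<lambda>i. t (u, i)) (\<lambda>i. t (v, i))"
  have s: "inj s"
    using uv by (intro injI) (auto simp: s_def inj_eq[OF t] split: sum.splits)
  define f :: "'k set set \<Rightarrow> 'k set \<Rightarrow> 'k" where "f X = (SOME g. inj_on g X)" for X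
  have f: "inj_on (f X) X" if "?sm X" for X
    using that unfolding f_def by (rule someI_ex)
  define code where "code X = s ` (Inl ` f X ` X \<union> Inr ` t ` {(f X x, j) |x j. x \<in> X \<and> j \<in> x})" for X
  define dec where "dec S = {{j. Inr (t (i, j)) \<in> s -` S} |i. Inl i \<in> s -` S}" for S
  have dec: "dec (code X) = X" if "?sm X" for X
  proof -
    have vim: "s -` code X = Inl ` f X ` X \<union> Inr ` t ` {(f X x, j) |x j. x \<in> X \<and> j \<in> x}"
      unfolding code_def by (rule inj_vimage_image_eq[OF s])
    have eq: "{j. Inr (t (f X x, j)) \<in> s -` code X} = x" if "x \<in> X" for x
      unfolding vim using that inj_onD[OF f[OF \<open>?sm X\<close>]] by (auto simp: image_iff inj_eq[OF t])
    have "dec (code X) = (\<lambda>x. {j. Inr (t (f X x, j)) \<in> s -` code X}) ` X"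
      unfolding dec_def by (auto simp: vim)
    also have "\<dots> = X" using eq by force
    finally show ?thesis .
  qed
  have "inj_on code {X. ?sm X}"
    by (rule inj_on_inverseI[where g = dec]) (simp add: dec)
  moreover have "?sm Y" if "?sm X" "Y \<subseteq> X" for X Y
    using that inj_on_subset by blast
  moreover have "?sm (g ` X)" if "?sm X" for X g
  proof -
    from that obtain h :: "'k set \<Rightarrow> 'k" where h: "inj_on h X" by blast
    have "inj_on (\<lambda>y. h (inv_into X g y)) (g ` X)"
      by (rule inj_onI) (metis h f_inv_into_f inj_onD inv_into_into)
    then show ?thesis by blast
  qed
  ultimately show ?thesis unfolding universe_def by blast
qed


section \<open>The two categories\<close>

definition Inf_lin :: "('u set \<Rightarrow> bool) \<Rightarrow> ('u lis, ('u \<times> 'u) set) cat" where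
  "Inf_lin small =
     \<lparr>Obj = {A. is_lis A \<and> small (tokens A)},
      Hom = (\<lambda>A B. {R. linear_approximable A B R}),
      Ident = ent,
      Comp = (\<lambda>A B C S R. R O S)\<rparr>"

text \<open>Functions between domains are taken to be \<open>undefined\<close> outside the carrier, so that equality of
  arrows is equality of functions on the domain.\<close>

definition Psd :: "('u set \<Rightarrow> bool) \<Rightarrow> ('u gorder, 'u \<Rightarrow> 'u) cat" where
  "Psd small =
     \<lparr>Obj = {D. scott_domain D \<and> prime_algebraic D \<and> small (primes D)},
      Hom = (\<lambda>D E. {f \<in> extensional (carrier D). linear_function D E f}),
      Ident = (\<lambda>D. \<lambda>x\<in>carrier D. x),
      Comp = (\<lambda>D E F g f. compose (carrier D) g f)\<rparr>"


section \<open>The two functors\<close>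

definition plus_obj :: "('u set \<Rightarrow> 'u) \<Rightarrow> 'u lis \<Rightarrow> 'u gorder" where
  "plus_obj code A =
     \<lparr>carrier = code ` points A,
      eq = (=),
      le = (\<lambda>u v. \<exists>x\<in>points A. \<exists>y\<in>points A. u = code x \<and> v = code y \<and> x \<subseteq> y)\<rparr>"

definition plus_functor ::
    "('u set \<Rightarrow> 'u) \<Rightarrow> ('u lis, ('u \<times> 'u) set, 'u gorder, 'u \<Rightarrow> 'u) fctr" where
  "plus_functor code =
     \<lparr>omap = plus_obj code,
      amap = (\<lambda>A B R. \<lambda>u\<in>code ` points A. code (rel_plus R (inv_into (points A) code u)))\<rparr>"

definition minus_obj :: "'u gorder \<Rightarrow> 'u lis" where
  "minus_obj D =
     \<lparr>tokens = primes D,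
      con = {a. finite a \<and> a \<subseteq> primes D \<and> Upper D a \<noteq> {}},
      ent = {(p, p'). p \<in> primes D \<and> p' \<in> primes D \<and> p' \<sqsubseteq>\<^bsub>D\<^esub> p}\<rparr>"

definition minus_functor :: "('u gorder, 'u \<Rightarrow> 'u, 'u lis, ('u \<times> 'u) set) fctr" where
  "minus_functor =
     \<lparr>omap = minus_obj,
      amap = (\<lambda>D E f. {(p, p'). p \<in> primes D \<and> p' \<in> primes E \<and> p' \<sqsubseteq>\<^bsub>E\<^esub> f p})\<rparr>"

end

theory Submission
  imports Defs
begin

text \<open>In the poset of points of a system joins are unions, and the primes are exactly the closures of
  single tokens, so passing to primes recovers the system up to interderivability of tokens.
  Conversely, a prime lies below an arbitrary join only if it lies below one of its members: by
  compactness the join may be taken finite. Hence in a prime algebraic domain \<open>d \<mapsto> {p prime. p \<le> d}\<close> is an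
  order isomorphism onto the points of the system of primes, and a linear function is determined by
  which primes lie below its values at primes.\<close>

section \<open>Least upper bounds and primes\<close>

text \<open>Points are sets of tokens, yet the objects of both categories live over
  \<open>'u\<close>, so every statement about points is transported along \<open>code\<close>. At a
  single object all that is used of \<open>code\<close> is injectivity on the points of that system.
  Smallness guarantees this, and it survives both constructions: the primes of a domain of points
  are an image of the tokens, and the tokens of a system of primes are the primes. The empty case is
  the other constraint. Since \<open>{} \<in> con A\<close> may fail, no least element can be taken
  for granted, and even the empty join must come from a bound. The two natural isomorphisms have
  different shapes. An isomorphism of systems is a relation and need not match tokens one to one, so
  the unit is a graph saturated under entailment; the counit is the inverse of an order
  isomorphism.\<close>

lemma is_lub_iff:
  assumes "S \<subseteq> carrier D"
  shows "is_lub D S s \<longleftrightarrow> s \<in> carrier D \<and> (\<forall>x\<in>S. x \<sqsubseteq>\<^bsub>D\<^esub> s) \<and>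
    (\<forall>u\<in>carrier D. (\<forall>x\<in>S. x \<sqsubseteq>\<^bsub>D\<^esub> u) \<longrightarrow> s \<sqsubseteq>\<^bsub>D\<^esub> u)"
  using assms unfolding is_lub_def least_def Upper_def by blast

text \<open>\<open>Upper\<close> disregards members of its argument outside the carrier; hence the
  inclusion assumed here and in \<open>is_lub_iff\<close>.\<close>

lemma Upper_nonempty_iff:
  assumes "S \<subseteq> carrier D"
  shows "Upper D S \<noteq> {} \<longleftrightarrow> (\<exists>u\<in>carrier D. \<forall>x\<in>S. x \<sqsubseteq>\<^bsub>D\<^esub> u)"
  using assms unfolding Upper_def by blast

lemma scott_domain_partial_order: "scott_domain D \<Longrightarrow> partial_order D"
  by (simp add: scott_domain_def)

lemma primes_subset_carrier: "primes D \<subseteq> carrier D"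
  by (auto simp: primes_def compact_elements_def)

text \<open>The standard device for replacing a set whose finite subsets are bounded by a directed
  set with the same upper bounds.\<close>

definition finite_joins :: "'a gorder \<Rightarrow> 'a set \<Rightarrow> 'a set" where
  "finite_joins D S = {t. \<exists>F. finite F \<and> F \<subseteq> S \<and> is_lub D F t}"

context
  fixes D :: "'a gorder" and S :: "'a set"
  assumes D: "scott_domain D" and S: "S \<subseteq> carrier D"
    and bounded: "\<And>F. finite F \<Longrightarrow> F \<subseteq> S \<Longrightarrow> Upper D F \<noteq> {}"
begin

lemma finite_join_exists:
  assumes "finite F" "F \<subseteq> S"
  shows "\<exists>t. is_lub D F t"
proof -
  have "F \<subseteq> carrier D" using assms(2) S by blast
  then show ?thesis using D bounded[OF assms] unfolding scott_domain_def by blast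
qed

lemma finite_joins_carrier: "finite_joins D S \<subseteq> carrier D"
  using S by (auto simp: finite_joins_def is_lub_def)

lemma directed_finite_joins: "directed D (finite_joins D S)"
  unfolding directed_def
proof (intro conjI ballI finite_joins_carrier)
  \<comment> \<open>The empty subset has a join because \<open>bounded\<close> at \<open>{}\<close>
    makes the carrier nonempty; this join is the least element.\<close>
  show "finite_joins D S \<noteq> {}"
    using finite_join_exists[of "{}"] by (auto simp: finite_joins_def)
  fix x y assume "x \<in> finite_joins D S" "y \<in> finite_joins D S"
  then obtain F G where F: "finite F" "F \<subseteq> S" "is_lub D F x"
    and G: "finite G" "G \<subseteq> S" "is_lub D G y"
    by (auto simp: finite_joins_def)
  from F G obtain z where z: "is_lub D (F \<union> G) z"
    using finite_join_exists[of "F \<union> G"] by auto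
  have c: "F \<subseteq> carrier D" "G \<subseteq> carrier D" "F \<union> G \<subseteq> carrier D" using F G S by auto
  have "x \<sqsubseteq>\<^bsub>D\<^esub> z" "y \<sqsubseteq>\<^bsub>D\<^esub> z"
    using F(3) G(3) z by (auto simp: is_lub_iff[OF c(1)] is_lub_iff[OF c(2)] is_lub_iff[OF c(3)])
  moreover have "z \<in> finite_joins D S"
    using F G z by (auto simp: finite_joins_def intro!: exI[of _ "F \<union> G"])
  ultimately show "\<exists>z\<in>finite_joins D S. x \<sqsubseteq>\<^bsub>D\<^esub> z \<and> y \<sqsubseteq>\<^bsub>D\<^esub> z" by blast
qed

lemma Upper_finite_joins: "Upper D (finite_joins D S) = Upper D S"
proof -
  interpret partial_order D using D by (rule scott_domain_partial_order)
  show ?thesis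
  proof (intro equalityI subsetI)
    fix u assume u: "u \<in> Upper D S"
    show "u \<in> Upper D (finite_joins D S)"
    proof (rule Upper_memI)
      fix t assume "t \<in> finite_joins D S"
      then obtain F where F: "F \<subseteq> S" "is_lub D F t" by (auto simp: finite_joins_def)
      have "u \<in> Upper D F" using u Upper_antimono[OF F(1)] by blast
      then show "t \<sqsubseteq>\<^bsub>D\<^esub> u"
        using F(2) by (simp add: is_lub_def least_def)
    qed (use u in \<open>auto simp: Upper_def\<close>)
  next
    fix u assume u: "u \<in> Upper D (finite_joins D S)"
    show "u \<in> Upper D S"
    proof (rule Upper_memI)
      fix s assume s: "s \<in> S"
      then have "is_lub D {s} s" using S by (auto simp: is_lub_iff)
      then have "s \<in> finite_joins D S"
        using s by (auto simp: finite_joins_def intro!: exI[of _ "{s}"])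
      then show "s \<sqsubseteq>\<^bsub>D\<^esub> u" using u S s by (auto simp: Upper_def)
    qed (use u in \<open>auto simp: Upper_def\<close>)
  qed
qed

lemma is_lub_finite_joins: "is_lub D (finite_joins D S) s \<longleftrightarrow> is_lub D S s"
  by (simp add: is_lub_def Upper_finite_joins)

text \<open>The axioms give joins of bounded sets and of directed sets, whereas a point of the
  system of primes is only known to have bounded finite subsets. The directed set of finite joins
  bridges the gap.\<close>

lemma finitely_bounded_lub_exists: "\<exists>s. is_lub D S s"
  using D directed_finite_joins unfolding scott_domain_def is_lub_finite_joins[symmetric] by blast

end

text \<open>Compactness reduces the join to a finite one, so primes are prime for arbitrary joins.\<close>

lemma prime_le_lubD:
  assumes D: "scott_domain D" and S: "S \<subseteq> carrier D" and s: "is_lub D S s"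
    and p: "p \<in> primes D" and le: "p \<sqsubseteq>\<^bsub>D\<^esub> s"
  obtains b where "b \<in> S" "p \<sqsubseteq>\<^bsub>D\<^esub> b"
proof -
  have bounded: "Upper D F \<noteq> {}" if "F \<subseteq> S" for F
    using s Upper_antimono[OF that, of D] by (auto simp: is_lub_def least_def)
  have "is_lub D (finite_joins D S) s"
    using s by (simp add: is_lub_finite_joins[OF D S bounded])
  then obtain t where t: "t \<in> finite_joins D S" "p \<sqsubseteq>\<^bsub>D\<^esub> t"
    using p le directed_finite_joins[OF D S bounded]
    unfolding primes_def compact_elements_def by blast
  then obtain F where F: "finite F" "F \<subseteq> S" "is_lub D F t" by (auto simp: finite_joins_def)
  then have "\<exists>b\<in>F. p \<sqsubseteq>\<^bsub>D\<^esub> b"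
    using p t(2) S bounded[OF F(2)] unfolding primes_def by (blast dest: subset_trans)
  then show ?thesis using F(2) that by blast
qed


section \<open>Linear functions\<close>

text \<open>Preservation of joins suffices: if x is below y then y is the join of the pair, which
  gives monotonicity, and continuity is the directed case.\<close>

lemma linear_functionI:
  assumes D: "partial_order D" and E: "partial_order E" and f: "f \<in> carrier D \<rightarrow> carrier E"
    and lub: "\<And>S s. S \<subseteq> carrier D \<Longrightarrow> is_lub D S s \<Longrightarrow> is_lub E (f ` S) (f s)"
  shows "linear_function D E f"
proof -
  interpret D: partial_order D by (rule D)
  interpret E: partial_order E by (rule E)
  have "f x \<sqsubseteq>\<^bsub>E\<^esub> f y" if "x \<in> carrier D" "y \<in> carrier D" "x \<sqsubseteq>\<^bsub>D\<^esub> y" for x y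
  proof -
    have "is_lub D {x, y} y" using that by (auto simp: is_lub_iff)
    then have "is_lub E (f ` {x, y}) (f y)" using that by (intro lub) auto
    then show ?thesis using that f by (subst (asm) is_lub_iff) auto
  qed
  then have "isotone D E f"
    by (auto simp: isotone_def D.weak_partial_order_axioms E.weak_partial_order_axioms)
  then show ?thesis
    using f lub by (auto simp: linear_function_def scott_continuous_def directed_def)
qed

lemma linear_function_closed: "linear_function D E f \<Longrightarrow> x \<in> carrier D \<Longrightarrow> f x \<in> carrier E"
  by (auto simp: linear_function_def scott_continuous_def)

lemma linear_function_mono:
  "linear_function D E f \<Longrightarrow> x \<in> carrier D \<Longrightarrow> y \<in> carrier D \<Longrightarrow> x \<sqsubseteq>\<^bsub>D\<^esub> y \<Longrightarrow> f x \<sqsubseteq>\<^bsub>E\<^esub> f y"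
  by (auto simp: linear_function_def scott_continuous_def isotone_def)

lemma linear_function_lub:
  "linear_function D E f \<Longrightarrow> S \<subseteq> carrier D \<Longrightarrow> is_lub D S s \<Longrightarrow> is_lub E (f ` S) (f s)"
  by (auto simp: linear_function_def)

text \<open>Arrows of \<open>Psd\<close> are restricted to the carrier; this moves linearity from a
  plain function to its restriction.\<close>

lemma linear_function_cong:
  assumes "partial_order D" "partial_order E" "linear_function D E f"
    and eq: "\<And>x. x \<in> carrier D \<Longrightarrow> g x = f x"
  shows "linear_function D E g"
proof (rule linear_functionI[OF assms(1,2)])
  show "g \<in> carrier D \<rightarrow> carrier E" using linear_function_closed[OF assms(3)] eq by auto
  fix S s assume S: "S \<subseteq> carrier D" and s: "is_lub D S s"
  have "g ` S = f ` S" using S eq by (intro image_cong) auto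
  moreover have "g s = f s" using s S eq by (auto simp: is_lub_iff)
  ultimately show "is_lub E (g ` S) (g s)" using linear_function_lub[OF assms(3) S s] by simp
qed

text \<open>An upper bound \<open>u\<close> of the image is pulled back to the upper bound
  \<open>g u\<close> of \<open>S\<close>, because \<open>f\<close> reflects the order.\<close>

lemma linear_function_order_iso:
  assumes D: "partial_order D" and E: "partial_order E"
    and f: "f \<in> carrier D \<rightarrow> carrier E" and g: "g \<in> carrier E \<rightarrow> carrier D"
    and fg: "\<And>y. y \<in> carrier E \<Longrightarrow> f (g y) = y"
    and le: "\<And>x y. x \<in> carrier D \<Longrightarrow> y \<in> carrier D \<Longrightarrow> f x \<sqsubseteq>\<^bsub>E\<^esub> f y \<longleftrightarrow> x \<sqsubseteq>\<^bsub>D\<^esub> y"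
  shows "linear_function D E f"
proof (rule linear_functionI[OF D E f])
  fix S s assume S: "S \<subseteq> carrier D" and "is_lub D S s"
  then have s: "s \<in> carrier D" "\<And>x. x \<in> S \<Longrightarrow> x \<sqsubseteq>\<^bsub>D\<^esub> s"
    "\<And>u. u \<in> carrier D \<Longrightarrow> \<forall>x\<in>S. x \<sqsubseteq>\<^bsub>D\<^esub> u \<Longrightarrow> s \<sqsubseteq>\<^bsub>D\<^esub> u" by (auto simp: is_lub_iff)
  have fS: "f ` S \<subseteq> carrier E" using S f by auto
  show "is_lub E (f ` S) (f s)"
    unfolding is_lub_iff[OF fS]
  proof (intro conjI ballI impI)
    fix u assume u: "u \<in> carrier E" "\<forall>x\<in>f ` S. x \<sqsubseteq>\<^bsub>E\<^esub> u"
    have gu: "g u \<in> carrier D" "f (g u) = u" using u g fg by auto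
    have "\<forall>x\<in>S. x \<sqsubseteq>\<^bsub>D\<^esub> g u" using u(2) le[OF _ gu(1)] gu(2) S by (simp add: subset_iff)
    then have "s \<sqsubseteq>\<^bsub>D\<^esub> g u" using s(3) gu(1) by blast
    then show "f s \<sqsubseteq>\<^bsub>E\<^esub> u" using le[OF s(1) gu(1)] gu(2) by simp
  qed (use s S f le in auto)
qed


section \<open>The poset of points\<close>

text \<open>For a token of a system this is the least point containing it, the candidate for a
  prime.\<close>

definition token_closure :: "'a lis \<Rightarrow> 'a \<Rightarrow> 'a set" where
  "token_closure A \<alpha> = {\<beta>. (\<alpha>, \<beta>) \<in> ent A}"

text \<open>The source of two facts: directed unions of points are points, and finitely generated
  points are compact.\<close>

lemma finite_subset_directed_Union:
  assumes "finite a" "a \<subseteq> \<Union>X" "X \<noteq> {}" and dir: "\<And>x y. x \<in> X \<Longrightarrow> y \<in> X \<Longrightarrow> \<exists>z\<in>X. x \<subseteq> z \<and> y \<subseteq> z"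
  shows "\<exists>x\<in>X. a \<subseteq> x"
  using assms(1,2)
proof (induction a)
  case empty
  then show ?case using assms(3) by blast
next
  case (insert \<alpha> a)
  then obtain x y where "x \<in> X" "a \<subseteq> x" "y \<in> X" "\<alpha> \<in> y" by auto
  moreover from this obtain z where "z \<in> X" "x \<subseteq> z" "y \<subseteq> z" using dir by meson
  ultimately show ?case by auto
qed

text \<open>Closure under entailment passes to any union; the bound \<open>y\<close> is what
  supplies consistency of the finite subsets.\<close>

lemma points_Union_bounded:
  assumes "X \<subseteq> points A" "y \<in> points A" "\<Union>X \<subseteq> y"
  shows "\<Union>X \<in> points A"
proof -
  have "a \<in> con A" if "finite a" "a \<subseteq> \<Union>X" for a
    using that assms(2) subset_trans[OF that(2) assms(3)] by (simp add: points_def)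
  moreover have "\<Union>X \<subseteq> tokens A" "\<forall>\<alpha> \<alpha>'. \<alpha> \<in> \<Union>X \<and> (\<alpha>, \<alpha>') \<in> ent A \<longrightarrow> \<alpha>' \<in> \<Union>X"
    using assms(1) by (auto simp: points_def) blast
  ultimately show ?thesis by (simp add: points_def)
qed

lemma points_Union_directed:
  assumes "X \<subseteq> points A" "X \<noteq> {}" "\<And>x y. x \<in> X \<Longrightarrow> y \<in> X \<Longrightarrow> \<exists>z\<in>X. x \<subseteq> z \<and> y \<subseteq> z"
  shows "\<Union>X \<in> points A"
proof -
  have "a \<in> con A" if "finite a" "a \<subseteq> \<Union>X" for a
  proof -
    obtain x where "x \<in> X" "a \<subseteq> x"
      using finite_subset_directed_Union[OF \<open>finite a\<close> \<open>a \<subseteq> \<Union>X\<close> assms(2,3)] by blast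
    then show ?thesis using assms(1) \<open>finite a\<close> by (auto simp: points_def)
  qed
  moreover have "\<Union>X \<subseteq> tokens A" "\<forall>\<alpha> \<alpha>'. \<alpha> \<in> \<Union>X \<and> (\<alpha>, \<alpha>') \<in> ent A \<longrightarrow> \<alpha>' \<in> \<Union>X"
    using assms(1) by (auto simp: points_def) blast
  ultimately show ?thesis by (simp add: points_def)
qed

context
  fixes A :: "'u lis"
  assumes lis: "is_lis A"
begin

lemma token_closure_refl: "\<alpha> \<in> tokens A \<Longrightarrow> \<alpha> \<in> token_closure A \<alpha>"
  using lis by (auto simp: token_closure_def is_lis_def)

text \<open>Turns the order relation between a generator and a point into membership of a token.
  Primality of generators rests on this, since a token of a union belongs to one of its
  members.\<close>

lemma token_closure_subset:
  "x \<in> points A \<Longrightarrow> \<alpha> \<in> tokens A \<Longrightarrow> token_closure A \<alpha> \<subseteq> x \<longleftrightarrow> \<alpha> \<in> x"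
  using token_closure_refl by (auto simp: points_def token_closure_def)

lemma token_closure_point:
  assumes "\<alpha> \<in> tokens A"
  shows "token_closure A \<alpha> \<in> points A"
proof -
  have ent: "ent A \<subseteq> tokens A \<times> tokens A" "trans (ent A)" and sing: "{\<alpha>} \<in> con A"
    using lis assms by (auto simp: is_lis_def)
  have "a \<in> con A" if "finite a" "a \<subseteq> token_closure A \<alpha>" for a
  proof -
    have "a \<subseteq> tokens A" "\<forall>\<beta>\<in>a. \<exists>\<gamma>\<in>{\<alpha>}. (\<gamma>, \<beta>) \<in> ent A"
      using that(2) ent by (auto simp: token_closure_def)
    then show ?thesis using lis sing that(1) unfolding is_lis_def by blast
  qed
  then show ?thesis using ent by (auto simp: points_def token_closure_def dest: transD)
qed

lemma point_eq_Union_token_closure: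
  assumes "x \<in> points A"
  shows "x = \<Union>(token_closure A ` x)"
proof -
  have "x \<subseteq> tokens A" using assms by (auto simp: points_def)
  then show ?thesis using token_closure_subset[OF assms] token_closure_refl by blast
qed

context
  fixes code :: "'u set \<Rightarrow> 'u"
  assumes inj: "inj_on code (points A)"
begin

section \<open>Order and joins of encoded points\<close>

lemma plus_carrier: "carrier (plus_obj code A) = code ` points A"
  by (simp add: plus_obj_def)

lemma plus_le_iff:
  "x \<in> points A \<Longrightarrow> y \<in> points A \<Longrightarrow> code x \<sqsubseteq>\<^bsub>plus_obj code A\<^esub> code y \<longleftrightarrow> x \<subseteq> y"
  by (auto simp: plus_obj_def inj_on_eq_iff[OF inj])

lemma plus_partial_order: "partial_order (plus_obj code A)"
proof
  show "(.=\<^bsub>plus_obj code A\<^esub>) = (=)" by (simp add: plus_obj_def)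
  fix x y z assume "x \<in> carrier (plus_obj code A)" "y \<in> carrier (plus_obj code A)"
    "z \<in> carrier (plus_obj code A)" "x \<sqsubseteq>\<^bsub>plus_obj code A\<^esub> y" "y \<sqsubseteq>\<^bsub>plus_obj code A\<^esub> z"
  then show "x \<sqsubseteq>\<^bsub>plus_obj code A\<^esub> z" by (auto simp: plus_carrier plus_le_iff)
next
  fix x y assume "x \<in> carrier (plus_obj code A)" "y \<in> carrier (plus_obj code A)"
    "x \<sqsubseteq>\<^bsub>plus_obj code A\<^esub> y" "y \<sqsubseteq>\<^bsub>plus_obj code A\<^esub> x"
  then have "x = y" by (auto simp: plus_carrier plus_le_iff)
  then show "x .=\<^bsub>plus_obj code A\<^esub> y" by (simp add: plus_obj_def)
qed (auto simp: plus_carrier plus_le_iff, auto simp: plus_obj_def inj_on_eq_iff[OF inj])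

lemma plus_subset_carrierE:
  assumes "S \<subseteq> carrier (plus_obj code A)"
  obtains X where "X \<subseteq> points A" "S = code ` X"
  using assms unfolding plus_carrier subset_image_iff by blast

text \<open>A join, if it exists, is a point bounding the family, so the union is itself a point by
  \<open>points_Union_bounded\<close>; being the least set above all members, it must be the
  join.\<close>

lemma plus_is_lub_iff:
  assumes X: "X \<subseteq> points A"
  shows "is_lub (plus_obj code A) (code ` X) u \<longleftrightarrow> \<Union>X \<in> points A \<and> u = code (\<Union>X)"
proof
  have c: "code ` X \<subseteq> carrier (plus_obj code A)" using X by (auto simp: plus_carrier)
  {
    assume L: "is_lub (plus_obj code A) (code ` X) u"
    then obtain s where s: "s \<in> points A" "u = code s" using c by (auto simp: is_lub_iff plus_carrier)
    have ub: "\<Union>X \<subseteq> s" using L X s c plus_le_iff[OF _ s(1)] by (simp add: is_lub_iff subset_iff) blast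
    then have U: "\<Union>X \<in> points A" using points_Union_bounded X s by blast
    moreover have "s \<subseteq> \<Union>X"
    proof -
      have "\<forall>x\<in>code ` X. x \<sqsubseteq>\<^bsub>plus_obj code A\<^esub> code (\<Union>X)" using X U plus_le_iff by auto
      then have "code s \<sqsubseteq>\<^bsub>plus_obj code A\<^esub> code (\<Union>X)"
        using L U s by (auto simp: is_lub_iff[OF c] plus_carrier)
      then show ?thesis using plus_le_iff s U by blast
    qed
    ultimately show "\<Union>X \<in> points A \<and> u = code (\<Union>X)" using ub s by auto
  next
    assume U: "\<Union>X \<in> points A \<and> u = code (\<Union>X)"
    have "\<forall>y\<in>points A. (\<forall>x\<in>X. code x \<sqsubseteq>\<^bsub>plus_obj code A\<^esub> code y) \<longrightarrow>
      code (\<Union>X) \<sqsubseteq>\<^bsub>plus_obj code A\<^esub> code y"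
    proof (intro ballI impI)
      fix y assume y: "y \<in> points A" and "\<forall>x\<in>X. code x \<sqsubseteq>\<^bsub>plus_obj code A\<^esub> code y"
      then have "\<Union>X \<subseteq> y" using X plus_le_iff[OF _ y] by blast
      then show "code (\<Union>X) \<sqsubseteq>\<^bsub>plus_obj code A\<^esub> code y" using U y plus_le_iff by blast
    qed
    moreover have "\<forall>x\<in>X. code x \<sqsubseteq>\<^bsub>plus_obj code A\<^esub> code (\<Union>X)"
      using U X plus_le_iff by auto
    ultimately show "is_lub (plus_obj code A) (code ` X) u"
      using U by (auto simp: is_lub_iff[OF c] plus_carrier)
  }
qed

lemma plus_directed_iff:
  assumes X: "X \<subseteq> points A"
  shows "directed (plus_obj code A) (code ` X) \<longleftrightarrow>
    X \<noteq> {} \<and> (\<forall>x\<in>X. \<forall>y\<in>X. \<exists>z\<in>X. x \<subseteq> z \<and> y \<subseteq> z)"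
proof -
  have le: "code x \<sqsubseteq>\<^bsub>plus_obj code A\<^esub> code y \<longleftrightarrow> x \<subseteq> y" if "x \<in> X" "y \<in> X" for x y
    using that X plus_le_iff by blast
  have "code ` X \<subseteq> carrier (plus_obj code A)" using X by (auto simp: plus_carrier)
  moreover have "(\<forall>x\<in>X. \<forall>y\<in>X. \<exists>z\<in>X. code x \<sqsubseteq>\<^bsub>plus_obj code A\<^esub> code z \<and> code y \<sqsubseteq>\<^bsub>plus_obj code A\<^esub> code z) \<longleftrightarrow>
    (\<forall>x\<in>X. \<forall>y\<in>X. \<exists>z\<in>X. x \<subseteq> z \<and> y \<subseteq> z)"
    by (intro ball_cong bex_cong conj_cong refl le)
  ultimately show ?thesis by (simp add: directed_def)
qed

section \<open>Finitely generated points and compact elements\<close>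

lemma finite_closure_point:
  assumes "x \<in> points A" "a \<subseteq> x"
  shows "\<Union>(token_closure A ` a) \<in> points A" "\<Union>(token_closure A ` a) \<subseteq> x"
proof -
  have a: "a \<subseteq> tokens A" using assms by (auto simp: points_def)
  show sub: "\<Union>(token_closure A ` a) \<subseteq> x"
    using a assms token_closure_subset[OF assms(1)] by blast
  show "\<Union>(token_closure A ` a) \<in> points A"
    using a sub assms(1) token_closure_point by (intro points_Union_bounded[of _ _ x]) auto
qed

text \<open>If a directed union contains the finitely many generators, one member does, and that
  member contains their closures.\<close>

lemma finite_closure_compact:
  assumes x: "x \<in> points A" and a: "a \<subseteq> x" "finite a"
  shows "code (\<Union>(token_closure A ` a)) \<in> compact_elements (plus_obj code A)"
  unfolding compact_elements_def
proof (intro CollectI conjI allI impI; (elim conjE)?)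
  note cl = finite_closure_point[OF x a(1)]
  show "code (\<Union>(token_closure A ` a)) \<in> carrier (plus_obj code A)"
    using cl by (simp add: plus_carrier)
  fix S s assume S: "directed (plus_obj code A) S" and s: "is_lub (plus_obj code A) S s"
    and le: "code (\<Union>(token_closure A ` a)) \<sqsubseteq>\<^bsub>plus_obj code A\<^esub> s"
  obtain X where X: "X \<subseteq> points A" "S = code ` X"
    using S plus_subset_carrierE[of S] unfolding directed_def by blast
  have U: "\<Union>X \<in> points A" "s = code (\<Union>X)" using s plus_is_lub_iff[OF X(1)] X(2) by auto
  have "\<Union>(token_closure A ` a) \<subseteq> \<Union>X" using le plus_le_iff cl(1) U by simp
  moreover have at: "a \<subseteq> tokens A" using x a(1) by (auto simp: points_def)
  ultimately have "a \<subseteq> \<Union>X" using token_closure_refl by blast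
  then obtain y where y: "y \<in> X" "a \<subseteq> y"
    using finite_subset_directed_Union[OF a(2), of X] S plus_directed_iff[OF X(1)] X(2) by blast
  then have "\<Union>(token_closure A ` a) \<subseteq> y" using finite_closure_point(2) X(1) by blast
  then have "code (\<Union>(token_closure A ` a)) \<sqsubseteq>\<^bsub>plus_obj code A\<^esub> code y"
    using plus_le_iff cl(1) y X(1) by blast
  then show "\<exists>d\<in>S. code (\<Union>(token_closure A ` a)) \<sqsubseteq>\<^bsub>plus_obj code A\<^esub> d"
    using y X(2) by blast
qed

text \<open>Directedness of the compact elements below \<open>code x\<close> is obtained without
  determining them: the finitely generated points inside \<open>x\<close> are directed and compact,
  and compactness makes them cofinal among all compact points inside \<open>x\<close>.\<close>

lemma plus_compact_below:
  assumes x: "x \<in> points A" and X: "X = {y \<in> points A. code y \<in> compact_elements (plus_obj code A) \<and> y \<subseteq> x}"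
  shows "{k \<in> compact_elements (plus_obj code A). k \<sqsubseteq>\<^bsub>plus_obj code A\<^esub> code x} = code ` X"
    and "\<Union>X = x" and "X \<noteq> {}" and "\<forall>y\<in>X. \<forall>z\<in>X. \<exists>w\<in>X. y \<subseteq> w \<and> z \<subseteq> w"
proof -
  let ?cl = "\<lambda>a. \<Union>(token_closure A ` a)"
  show "{k \<in> compact_elements (plus_obj code A). k \<sqsubseteq>\<^bsub>plus_obj code A\<^esub> code x} = code ` X"
    unfolding X using plus_le_iff[OF _ x] by (auto simp: compact_elements_def plus_carrier)
  have cl: "?cl a \<in> X" if "finite a" "a \<subseteq> x" for a
    using that x finite_closure_point[OF x] finite_closure_compact[OF x] by (auto simp: X)
  show "X \<noteq> {}" using cl[of "{}"] by auto
  have xt: "x \<subseteq> tokens A" using x by (auto simp: points_def)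
  show "\<Union>X = x"
  proof
    show "\<Union>X \<subseteq> x" by (auto simp: X)
    show "x \<subseteq> \<Union>X"
    proof
      fix \<alpha> assume "\<alpha> \<in> x"
      then show "\<alpha> \<in> \<Union>X" using cl[of "{\<alpha>}"] token_closure_refl xt by auto
    qed
  qed
  define C where "C = ?cl ` {a. finite a \<and> a \<subseteq> x}"
  have C: "C \<subseteq> points A" using finite_closure_point(1)[OF x] by (auto simp: C_def)
  have UC: "\<Union>C = x"
  proof
    show "\<Union>C \<subseteq> x" using finite_closure_point(2)[OF x] unfolding C_def by blast
    show "x \<subseteq> \<Union>C"
    proof
      fix \<alpha> assume "\<alpha> \<in> x"
      then show "\<alpha> \<in> \<Union>C" using token_closure_refl xt
        by (auto simp: C_def intro!: exI[of _ "{\<alpha>}"])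
    qed
  qed
  have "\<forall>y\<in>C. \<forall>z\<in>C. \<exists>w\<in>C. y \<subseteq> w \<and> z \<subseteq> w"
  proof (intro ballI)
    fix y z assume "y \<in> C" "z \<in> C"
    then obtain a b where "finite a" "a \<subseteq> x" "y = ?cl a" "finite b" "b \<subseteq> x" "z = ?cl b"
      by (auto simp: C_def)
    then show "\<exists>w\<in>C. y \<subseteq> w \<and> z \<subseteq> w"
      by (intro bexI[of _ "?cl (a \<union> b)"]) (simp_all add: C_def image_iff exI[of _ "a \<union> b"])
  qed
  moreover have "C \<noteq> {}" by (auto simp: C_def)
  ultimately have dir: "directed (plus_obj code A) (code ` C)" using plus_directed_iff[OF C] by blast
  have lub: "is_lub (plus_obj code A) (code ` C) (code x)" using plus_is_lub_iff[OF C] UC x by simp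
  \<comment> \<open>Compactness of \<open>code y\<close> is tested on the directed family
    \<open>C\<close>, whose union is \<open>x\<close>.\<close>
  have below: "\<exists>a. finite a \<and> a \<subseteq> x \<and> y \<subseteq> ?cl a" if "y \<in> X" for y
  proof -
    have "code y \<in> compact_elements (plus_obj code A)" "code y \<sqsubseteq>\<^bsub>plus_obj code A\<^esub> code x" "y \<in> points A"
      using that x plus_le_iff by (auto simp: X)
    then obtain c where "c \<in> C" "code y \<sqsubseteq>\<^bsub>plus_obj code A\<^esub> code c"
      using dir lub unfolding compact_elements_def by blast
    then show ?thesis using plus_le_iff[OF \<open>y \<in> points A\<close>] C unfolding C_def by blast
  qed
  show "\<forall>y\<in>X. \<forall>z\<in>X. \<exists>w\<in>X. y \<subseteq> w \<and> z \<subseteq> w"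
  proof (intro ballI)
    fix y z assume "y \<in> X" "z \<in> X"
    then obtain a b where "finite a" "a \<subseteq> x" "y \<subseteq> ?cl a" "finite b" "b \<subseteq> x" "z \<subseteq> ?cl b"
      using below by meson
    then show "\<exists>w\<in>X. y \<subseteq> w \<and> z \<subseteq> w"
      by (intro bexI[of _ "?cl (a \<union> b)"] cl) auto
  qed
qed

lemma plus_scott_domain: "scott_domain (plus_obj code A)"
  unfolding scott_domain_def
proof (intro conjI allI ballI impI; (elim conjE)?)
  show "partial_order (plus_obj code A)" by (rule plus_partial_order)
next
  fix S assume S: "directed (plus_obj code A) S"
  then obtain X where X: "X \<subseteq> points A" "S = code ` X"
    using plus_subset_carrierE[of S] unfolding directed_def by blast
  then have "\<Union>X \<in> points A"
    using S plus_directed_iff[OF X(1)] by (intro points_Union_directed) auto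
  then show "\<exists>s. is_lub (plus_obj code A) S s" using X plus_is_lub_iff by blast
next
  fix S assume S: "S \<subseteq> carrier (plus_obj code A)" and B: "Upper (plus_obj code A) S \<noteq> {}"
  obtain X where X: "X \<subseteq> points A" "S = code ` X" by (rule plus_subset_carrierE[OF S])
  obtain y where y: "y \<in> points A" "\<forall>x\<in>X. code x \<sqsubseteq>\<^bsub>plus_obj code A\<^esub> code y"
    using B X unfolding Upper_nonempty_iff[OF S] plus_carrier by blast
  then have "\<Union>X \<subseteq> y" using X(1) plus_le_iff[OF _ y(1)] by blast
  then have "\<Union>X \<in> points A" using points_Union_bounded X(1) y(1) by blast
  then show "\<exists>s. is_lub (plus_obj code A) S s" using X plus_is_lub_iff by blast
next
  fix u assume "u \<in> carrier (plus_obj code A)"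
  then obtain x where x: "x \<in> points A" "u = code x" by (auto simp: plus_carrier)
  define X where "X = {y \<in> points A. code y \<in> compact_elements (plus_obj code A) \<and> y \<subseteq> x}"
  note X = plus_compact_below[OF x(1) X_def]
  have Xp: "X \<subseteq> points A" by (auto simp: X_def)
  show "directed (plus_obj code A) {k \<in> compact_elements (plus_obj code A). k \<sqsubseteq>\<^bsub>plus_obj code A\<^esub> u}"
    using X by (simp add: x(2) plus_directed_iff[OF Xp])
  show "is_lub (plus_obj code A) {k \<in> compact_elements (plus_obj code A). k \<sqsubseteq>\<^bsub>plus_obj code A\<^esub> u} u"
    using X x by (simp add: plus_is_lub_iff[OF Xp])
qed

text \<open>A point is the union of the closures of its tokens, so a prime one is contained in one
  of these closures and equals it. Conversely, a closure is contained in a union exactly when its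
  generator belongs to a member.\<close>

lemma plus_primes: "primes (plus_obj code A) = (\<lambda>\<alpha>. code (token_closure A \<alpha>)) ` tokens A"
proof (intro equalityI subsetI)
  fix p assume p: "p \<in> primes (plus_obj code A)"
  then obtain x where x: "x \<in> points A" "p = code x"
    using primes_subset_carrier[of "plus_obj code A"] by (auto simp: plus_carrier)
  have xt: "x \<subseteq> tokens A" using x by (auto simp: points_def)
  have X: "token_closure A ` x \<subseteq> points A" using xt token_closure_point by auto
  then have c: "code ` token_closure A ` x \<subseteq> carrier (plus_obj code A)" by (auto simp: plus_carrier)
  have "is_lub (plus_obj code A) (code ` token_closure A ` x) p"
    unfolding plus_is_lub_iff[OF X] using point_eq_Union_token_closure[OF x(1)] x by simp
  moreover have "p \<sqsubseteq>\<^bsub>plus_obj code A\<^esub> p" using x plus_le_iff by simp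
  ultimately obtain b where "b \<in> code ` token_closure A ` x" "p \<sqsubseteq>\<^bsub>plus_obj code A\<^esub> b"
    using prime_le_lubD[OF plus_scott_domain c _ p] by blast
  then obtain \<alpha> where \<alpha>: "\<alpha> \<in> x" "p \<sqsubseteq>\<^bsub>plus_obj code A\<^esub> code (token_closure A \<alpha>)" by auto
  have "x \<subseteq> token_closure A \<alpha>"
    using \<alpha> xt x token_closure_point plus_le_iff by blast
  moreover have "token_closure A \<alpha> \<subseteq> x" using token_closure_subset \<alpha> xt x by blast
  ultimately show "p \<in> (\<lambda>\<alpha>. code (token_closure A \<alpha>)) ` tokens A" using x \<alpha> xt by auto
next
  fix p assume "p \<in> (\<lambda>\<alpha>. code (token_closure A \<alpha>)) ` tokens A"
  then obtain \<alpha> where \<alpha>: "\<alpha> \<in> tokens A" "p = code (token_closure A \<alpha>)" by auto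
  note pt = token_closure_point[OF \<alpha>(1)]
  have compact: "p \<in> compact_elements (plus_obj code A)"
    using finite_closure_compact[OF pt, of "{\<alpha>}"] token_closure_refl \<alpha> by simp
  have prime: "\<exists>b\<in>B. p \<sqsubseteq>\<^bsub>plus_obj code A\<^esub> b"
    if B: "B \<subseteq> carrier (plus_obj code A)" and s: "is_lub (plus_obj code A) B s"
      and le: "p \<sqsubseteq>\<^bsub>plus_obj code A\<^esub> s" for B s
  proof -
    obtain X where X: "X \<subseteq> points A" "B = code ` X" by (rule plus_subset_carrierE[OF B])
    have U: "\<Union>X \<in> points A" "s = code (\<Union>X)" using s X plus_is_lub_iff[OF X(1)] by auto
    then have "\<alpha> \<in> \<Union>X" using le \<alpha> pt plus_le_iff[OF pt U(1)] token_closure_refl by blast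
    then obtain x where "x \<in> X" "\<alpha> \<in> x" by blast
    then have "p \<sqsubseteq>\<^bsub>plus_obj code A\<^esub> code x"
      using \<alpha> X(1) plus_le_iff[OF pt] token_closure_subset by blast
    then show ?thesis using \<open>x \<in> X\<close> X(2) by blast
  qed
  show "p \<in> primes (plus_obj code A)"
    unfolding primes_def
    by (intro CollectI conjI compact allI impI; elim conjE) (rule prime)
qed

text \<open>The primes below \<open>code x\<close> encode the closures of the tokens of
  \<open>x\<close>, and these have union \<open>x\<close>.\<close>

lemma plus_prime_algebraic: "prime_algebraic (plus_obj code A)"
  unfolding prime_algebraic_def
proof
  fix u assume "u \<in> carrier (plus_obj code A)"
  then obtain x where x: "x \<in> points A" "u = code x" by (auto simp: plus_carrier)
  have xt: "x \<subseteq> tokens A" using x by (auto simp: points_def)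
  have X: "token_closure A ` x \<subseteq> points A" using xt token_closure_point by auto
  have "{p \<in> primes (plus_obj code A). p \<sqsubseteq>\<^bsub>plus_obj code A\<^esub> u} = code ` token_closure A ` x"
  proof -
    have "code (token_closure A \<alpha>) \<sqsubseteq>\<^bsub>plus_obj code A\<^esub> u \<longleftrightarrow> \<alpha> \<in> x" if "\<alpha> \<in> tokens A" for \<alpha>
      using that x plus_le_iff[OF token_closure_point x(1)] token_closure_subset by simp
    then show ?thesis using xt unfolding plus_primes by auto
  qed
  then show "is_lub (plus_obj code A) {p \<in> primes (plus_obj code A). p \<sqsubseteq>\<^bsub>plus_obj code A\<^esub> u} u"
    using plus_is_lub_iff[OF X] point_eq_Union_token_closure[OF x(1)] x by simp
qed

end

end


section \<open>Linear approximable relations\<close>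

text \<open>The set is the image of \<open>b\<close> under a choice function. The last conjunct
  records that every chosen element serves some member of \<open>b\<close>; it is used to see that
  an image of the chosen set is exactly \<open>b\<close>, and that the chosen elements are
  tokens.\<close>

lemma finite_witnesses:
  assumes "finite b" "\<forall>\<beta>\<in>b. \<exists>\<alpha>\<in>x. P \<alpha> \<beta>"
  shows "\<exists>a. finite a \<and> a \<subseteq> x \<and> (\<forall>\<beta>\<in>b. \<exists>\<alpha>\<in>a. P \<alpha> \<beta>) \<and> (\<forall>\<alpha>\<in>a. \<exists>\<beta>\<in>b. P \<alpha> \<beta>)"
proof -
  have "\<forall>\<beta>\<in>b. \<exists>\<alpha>. \<alpha> \<in> x \<and> P \<alpha> \<beta>" using assms(2) by (simp add: Bex_def)
  from bchoice[OF this] obtain f where "\<forall>\<beta>\<in>b. f \<beta> \<in> x \<and> P (f \<beta>) \<beta>" ..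
  then show ?thesis using assms(1) by (intro exI[of _ "f ` b"]) auto
qed

lemma is_lis_conI:
  assumes "is_lis A" "a \<in> con A" "finite b" "b \<subseteq> tokens A" "\<And>\<beta>. \<beta> \<in> b \<Longrightarrow> \<exists>\<alpha>\<in>a. (\<alpha>, \<beta>) \<in> ent A"
  shows "b \<in> con A"
proof -
  have "\<forall>a\<in>con A. \<forall>b. finite b \<and> b \<subseteq> tokens A \<and> (\<forall>\<beta>\<in>b. \<exists>\<alpha>\<in>a. (\<alpha>, \<beta>) \<in> ent A) \<longrightarrow> b \<in> con A"
    using assms(1) by (simp add: is_lis_def)
  from bspec[OF this assms(2)] show ?thesis using assms(3-5) by simp
qed

lemma is_lis_entD: "is_lis A \<Longrightarrow> (\<alpha>, \<beta>) \<in> ent A \<Longrightarrow> \<alpha> \<in> tokens A \<and> \<beta> \<in> tokens A"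
  by (auto simp: is_lis_def)

lemma is_lis_refl: "is_lis A \<Longrightarrow> \<alpha> \<in> tokens A \<Longrightarrow> (\<alpha>, \<alpha>) \<in> ent A"
  by (auto simp: is_lis_def)

lemma is_lis_trans: "is_lis A \<Longrightarrow> (\<alpha>, \<beta>) \<in> ent A \<Longrightarrow> (\<beta>, \<gamma>) \<in> ent A \<Longrightarrow> (\<alpha>, \<gamma>) \<in> ent A"
  by (auto simp: is_lis_def dest: transD)

lemma linear_approximable_conI:
  assumes "linear_approximable A B R" "a \<in> con A" "finite b" "b \<subseteq> tokens B"
    "\<And>\<beta>. \<beta> \<in> b \<Longrightarrow> \<exists>\<alpha>\<in>a. (\<alpha>, \<beta>) \<in> R"
  shows "b \<in> con B"
proof -
  have "\<forall>a\<in>con A. \<forall>b. finite b \<and> b \<subseteq> tokens B \<and> (\<forall>\<beta>\<in>b. \<exists>\<alpha>\<in>a. (\<alpha>, \<beta>) \<in> R) \<longrightarrow> b \<in> con B"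
    using assms(1) by (simp add: linear_approximable_def)
  from bspec[OF this assms(2)] show ?thesis using assms(3-5) by simp
qed

lemma linear_approximable_subset: "linear_approximable A B R \<Longrightarrow> R \<subseteq> tokens A \<times> tokens B"
  by (simp add: linear_approximable_def)

lemma linear_approximable_ent:
  "linear_approximable A B R \<Longrightarrow> (\<alpha>', \<alpha>) \<in> ent A \<Longrightarrow> (\<alpha>, \<beta>) \<in> R \<Longrightarrow> (\<beta>, \<beta>') \<in> ent B \<Longrightarrow> (\<alpha>', \<beta>') \<in> R"
  unfolding linear_approximable_def by blast

lemma linear_approximable_identity:
  assumes A: "is_lis A"
  shows "linear_approximable A A (ent A)"
  unfolding linear_approximable_def
proof (intro conjI allI ballI impI; (elim conjE)?)
  show "ent A \<subseteq> tokens A \<times> tokens A" using A by (simp add: is_lis_def)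
next
  fix a b assume "a \<in> con A" "finite b" "b \<subseteq> tokens A" "\<forall>\<beta>\<in>b. \<exists>\<alpha>\<in>a. (\<alpha>, \<beta>) \<in> ent A"
  then show "b \<in> con A" using is_lis_conI[OF A] by simp
next
  fix \<alpha>' \<alpha> \<beta> \<beta>' assume "(\<alpha>', \<alpha>) \<in> ent A" "(\<alpha>, \<beta>) \<in> ent A" "(\<beta>, \<beta>') \<in> ent A"
  then show "(\<alpha>', \<beta>') \<in> ent A" by (meson is_lis_trans[OF A])
qed

text \<open>Consistency travels through a finite set of intermediate tokens: \<open>R\<close> makes
  it consistent in \<open>B\<close>, then \<open>S\<close> makes the target consistent in
  \<open>C\<close>. Reflexivity at an intermediate token splits the entailment condition between the
  factors.\<close>

lemma linear_approximable_comp: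
  assumes B: "is_lis B" and R: "linear_approximable A B R" and S: "linear_approximable B C S"
  shows "linear_approximable A C (R O S)"
  unfolding linear_approximable_def
proof (intro conjI allI ballI impI; (elim conjE)?)
  show "R O S \<subseteq> tokens A \<times> tokens C"
    using linear_approximable_subset[OF R] linear_approximable_subset[OF S] by blast
next
  fix a c assume a: "a \<in> con A" and c: "finite c" "c \<subseteq> tokens C" "\<forall>\<gamma>\<in>c. \<exists>\<alpha>\<in>a. (\<alpha>, \<gamma>) \<in> R O S"
  then have "\<forall>\<gamma>\<in>c. \<exists>\<beta>\<in>{\<beta>. \<exists>\<alpha>\<in>a. (\<alpha>, \<beta>) \<in> R}. (\<beta>, \<gamma>) \<in> S" by blast
  from finite_witnesses[OF c(1) this] obtain b where
    b: "finite b" "b \<subseteq> {\<beta>. \<exists>\<alpha>\<in>a. (\<alpha>, \<beta>) \<in> R}" "\<forall>\<gamma>\<in>c. \<exists>\<beta>\<in>b. (\<beta>, \<gamma>) \<in> S"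
    by blast
  have "b \<in> con B"
    using b linear_approximable_subset[OF R] by (intro linear_approximable_conI[OF R a]) auto
  then show "c \<in> con C" using c(1,2) by (rule linear_approximable_conI[OF S]) (use b(3) in blast)
next
  fix \<alpha>' \<alpha> \<gamma> \<gamma>' assume h: "(\<alpha>', \<alpha>) \<in> ent A" "(\<alpha>, \<gamma>) \<in> R O S" "(\<gamma>, \<gamma>') \<in> ent C"
  then obtain \<beta> where \<beta>: "(\<alpha>, \<beta>) \<in> R" "(\<beta>, \<gamma>) \<in> S" by blast
  then have "(\<beta>, \<beta>) \<in> ent B" using linear_approximable_subset[OF R] is_lis_refl[OF B] by blast
  then have "(\<alpha>', \<beta>) \<in> R" "(\<beta>, \<gamma>') \<in> S"
    using h \<beta> linear_approximable_ent[OF R] linear_approximable_ent[OF S] by blast+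
  then show "(\<alpha>', \<gamma>') \<in> R O S" by blast
qed

text \<open>Entailment on one side is absorbed by (AR2) with reflexivity on the other; reflexivity
  also gives the reverse inclusion.\<close>

lemma ent_relcomp:
  assumes "is_lis A" "is_lis B" "linear_approximable A B R"
  shows "ent A O R = R" "R O ent B = R"
proof -
  note sub = linear_approximable_subset[OF assms(3)]
  have r: "(\<alpha>, \<alpha>) \<in> ent A \<and> (\<beta>, \<beta>) \<in> ent B" if "(\<alpha>, \<beta>) \<in> R" for \<alpha> \<beta>
    using that sub is_lis_refl[OF assms(1)] is_lis_refl[OF assms(2)] by blast
  show "ent A O R = R"
  proof (intro equalityI subrelI)
    fix \<alpha> \<beta> assume "(\<alpha>, \<beta>) \<in> ent A O R"
    then obtain \<gamma> where "(\<alpha>, \<gamma>) \<in> ent A" "(\<gamma>, \<beta>) \<in> R" by blast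
    then show "(\<alpha>, \<beta>) \<in> R" using r[of \<gamma> \<beta>] linear_approximable_ent[OF assms(3)] by blast
  qed (use r in blast)
  show "R O ent B = R"
  proof (intro equalityI subrelI)
    fix \<alpha> \<beta> assume "(\<alpha>, \<beta>) \<in> R O ent B"
    then obtain \<gamma> where "(\<alpha>, \<gamma>) \<in> R" "(\<gamma>, \<beta>) \<in> ent B" by blast
    then show "(\<alpha>, \<beta>) \<in> R" using r[of \<alpha> \<gamma>] linear_approximable_ent[OF assms(3)] by blast
  qed (use r in blast)
qed

lemma Inf_lin_category: "is_category (Inf_lin small)"
  unfolding is_category_def
proof (intro conjI ballI)
  fix A B C R S assume "B \<in> Obj (Inf_lin small)" "R \<in> Hom (Inf_lin small) A B" "S \<in> Hom (Inf_lin small) B C"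
  then show "Comp (Inf_lin small) A B C S R \<in> Hom (Inf_lin small) A C"
    using linear_approximable_comp[of B A R C S] by (simp add: Inf_lin_def)
next
  fix A B R
  assume "A \<in> Obj (Inf_lin small)" "B \<in> Obj (Inf_lin small)" "R \<in> Hom (Inf_lin small) A B"
  then show "Comp (Inf_lin small) A A B R (Ident (Inf_lin small) A) = R"
    "Comp (Inf_lin small) A B B (Ident (Inf_lin small) B) R = R"
    using ent_relcomp[of A B R] by (simp_all add: Inf_lin_def)
qed (simp_all add: Inf_lin_def linear_approximable_identity O_assoc)

text \<open>A finite part of the image has its witnesses in a finite part of \<open>x\<close>, which
  is consistent, so (AR1) applies.\<close>

lemma rel_plus_point:
  assumes A: "is_lis A" and R: "linear_approximable A B R" and x: "x \<in> points A"
  shows "rel_plus R x \<in> points B"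
  unfolding points_def
proof (intro CollectI conjI allI impI; (elim conjE)?)
  show sub: "rel_plus R x \<subseteq> tokens B" using linear_approximable_subset[OF R] by (auto simp: rel_plus_def)
  fix b assume b: "finite b" "b \<subseteq> rel_plus R x"
  then have "\<forall>\<beta>\<in>b. \<exists>\<alpha>\<in>x. (\<alpha>, \<beta>) \<in> R" by (auto simp: rel_plus_def)
  from finite_witnesses[OF b(1) this] obtain a where
    a: "finite a" "a \<subseteq> x" "\<forall>\<beta>\<in>b. \<exists>\<alpha>\<in>a. (\<alpha>, \<beta>) \<in> R" by blast
  then have "a \<in> con A" using x by (simp add: points_def)
  moreover have "b \<subseteq> tokens B" using b(2) sub by blast
  ultimately show "b \<in> con B" using a(3) b(1) by (intro linear_approximable_conI[OF R, of a]) auto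
next
  fix \<beta> \<beta>' assume "\<beta> \<in> rel_plus R x" and \<beta>': "(\<beta>, \<beta>') \<in> ent B"
  then obtain \<alpha> where \<alpha>: "\<alpha> \<in> x" "(\<alpha>, \<beta>) \<in> R" by (auto simp: rel_plus_def)
  then have "(\<alpha>, \<alpha>) \<in> ent A" using linear_approximable_subset[OF R] is_lis_refl[OF A] by blast
  then show "\<beta>' \<in> rel_plus R x"
    using \<alpha> \<beta>' linear_approximable_ent[OF R] unfolding rel_plus_def by blast
qed

lemma rel_plus_ent: "is_lis A \<Longrightarrow> x \<in> points A \<Longrightarrow> rel_plus (ent A) x = x"
  using is_lis_refl by (fastforce simp: rel_plus_def points_def)

lemma rel_plus_relcomp: "rel_plus (R O S) x = rel_plus S (rel_plus R x)"
  by (auto simp: rel_plus_def)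

text \<open>Since joins of points are unions, this is the reason the induced function is
  linear.\<close>

lemma rel_plus_Union: "rel_plus R (\<Union>X) = \<Union>(rel_plus R ` X)"
  by (auto simp: rel_plus_def)

text \<open>The map \<open>\<phi>\<close> need not be injective: interderivable tokens may be identified.\<close>

lemma lis_iso_of_surjection:
  fixes \<phi> :: "'u \<Rightarrow> 'u"
  assumes A: "is_lis A" and B: "is_lis B" and surj: "\<phi> ` tokens A = tokens B"
    and ent: "\<And>\<alpha> \<beta>. \<alpha> \<in> tokens A \<Longrightarrow> \<beta> \<in> tokens A \<Longrightarrow> (\<phi> \<alpha>, \<phi> \<beta>) \<in> ent B \<longleftrightarrow> (\<alpha>, \<beta>) \<in> ent A"
    and con: "\<And>a. finite a \<Longrightarrow> a \<subseteq> tokens A \<Longrightarrow> \<phi> ` a \<in> con B \<longleftrightarrow> a \<in> con A"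
  shows "is_iso (Inf_lin small) A B {(\<alpha>, \<phi> \<alpha>') |\<alpha> \<alpha>'. (\<alpha>, \<alpha>') \<in> ent A}"
proof -
  define \<eta> where "\<eta> = {(\<alpha>, \<phi> \<alpha>') |\<alpha> \<alpha>'. (\<alpha>, \<alpha>') \<in> ent A}"
  \<comment> \<open>The candidate inverse. Both relations are graphs of \<open>\<phi>\<close>, read
    in opposite directions, saturated under entailment as (AR2) requires.\<close>
  define \<theta> where "\<theta> = {(\<phi> \<alpha>, \<beta>) |\<alpha> \<beta>. (\<alpha>, \<beta>) \<in> ent A}"
  note tok = is_lis_entD[OF A] and tr = is_lis_trans[OF A]
  have etaD: "\<exists>\<gamma>. (\<alpha>, \<gamma>) \<in> ent A \<and> b = \<phi> \<gamma>" if "(\<alpha>, b) \<in> \<eta>" for \<alpha> b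
    using that by (auto simp: \<eta>_def)
  have thetaD: "\<exists>\<gamma>. (\<gamma>, \<beta>) \<in> ent A \<and> b = \<phi> \<gamma>" if "(b, \<beta>) \<in> \<theta>" for \<beta> b
    using that by (auto simp: \<theta>_def)
  have eta: "(\<alpha>, \<phi> \<beta>) \<in> \<eta> \<longleftrightarrow> (\<alpha>, \<beta>) \<in> ent A" if "\<beta> \<in> tokens A" for \<alpha> \<beta>
  proof
    assume "(\<alpha>, \<phi> \<beta>) \<in> \<eta>"
    then obtain \<gamma> where \<gamma>: "(\<alpha>, \<gamma>) \<in> ent A" "\<phi> \<gamma> = \<phi> \<beta>" using etaD by metis
    \<comment> \<open>Tokens with the same image under \<open>\<phi>\<close> entail each other, by
      reflexivity in \<open>A\<close> and the transfer \<open>ent\<close>.\<close>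
    then have "(\<gamma>, \<beta>) \<in> ent A" using ent[of \<gamma> \<beta>] ent[of \<beta> \<beta>] tok that is_lis_refl[OF A] by auto
    then show "(\<alpha>, \<beta>) \<in> ent A" using tr \<gamma>(1) by blast
  qed (auto simp: \<eta>_def)
  have theta: "(\<phi> \<alpha>, \<beta>) \<in> \<theta> \<longleftrightarrow> (\<alpha>, \<beta>) \<in> ent A" if "\<alpha> \<in> tokens A" for \<alpha> \<beta>
  proof
    assume "(\<phi> \<alpha>, \<beta>) \<in> \<theta>"
    then obtain \<gamma> where \<gamma>: "(\<gamma>, \<beta>) \<in> ent A" "\<phi> \<gamma> = \<phi> \<alpha>" using thetaD by metis
    then have "(\<alpha>, \<gamma>) \<in> ent A" using ent[of \<alpha> \<gamma>] ent[of \<alpha> \<alpha>] tok that is_lis_refl[OF A] by auto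
    then show "(\<alpha>, \<beta>) \<in> ent A" using tr \<gamma>(1) by blast
  qed (auto simp: \<theta>_def)
  have B_token: "\<exists>\<gamma>\<in>tokens A. b = \<phi> \<gamma>" if "b \<in> tokens B" for b
    using that surj by blast
  have eta_sub: "\<eta> \<subseteq> tokens A \<times> tokens B"
    unfolding \<eta>_def using tok surj by blast
  have theta_sub: "\<theta> \<subseteq> tokens B \<times> tokens A"
    unfolding \<theta>_def using tok surj by blast
  have lin_eta: "linear_approximable A B \<eta>"
    unfolding linear_approximable_def
  proof (intro conjI allI ballI impI eta_sub; elim conjE)
    fix a b assume a: "a \<in> con A" and b: "finite b" "b \<subseteq> tokens B" "\<forall>\<beta>\<in>b. \<exists>\<alpha>\<in>a. (\<alpha>, \<beta>) \<in> \<eta>"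
    \<comment> \<open>Members of \<open>b\<close> are lifted to tokens of \<open>A\<close> entailed
      by members of \<open>a\<close>. The lifted set is consistent by closure of
      \<open>con A\<close>, and \<open>con\<close> carries this to its image
      \<open>b\<close>.\<close>
    have "\<forall>\<beta>\<in>b. \<exists>\<gamma>\<in>{\<gamma>. \<exists>\<alpha>\<in>a. (\<alpha>, \<gamma>) \<in> ent A}. \<beta> = \<phi> \<gamma>"
    proof
      fix \<beta> assume "\<beta> \<in> b"
      then obtain \<alpha> where \<alpha>: "\<alpha> \<in> a" "(\<alpha>, \<beta>) \<in> \<eta>" using b(3) by blast
      from etaD[OF \<alpha>(2)] \<alpha>(1) show "\<exists>\<gamma>\<in>{\<gamma>. \<exists>\<alpha>\<in>a. (\<alpha>, \<gamma>) \<in> ent A}. \<beta> = \<phi> \<gamma>" by blast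
    qed
    from finite_witnesses[OF b(1) this] obtain c where
      c: "finite c" "c \<subseteq> {\<gamma>. \<exists>\<alpha>\<in>a. (\<alpha>, \<gamma>) \<in> ent A}"
      "\<forall>\<beta>\<in>b. \<exists>\<gamma>\<in>c. \<beta> = \<phi> \<gamma>" "\<forall>\<gamma>\<in>c. \<exists>\<beta>\<in>b. \<beta> = \<phi> \<gamma>"
      by (elim exE conjE)
    have ct: "c \<subseteq> tokens A" using c(2) tok by blast
    then have "c \<in> con A" using c by (intro is_lis_conI[OF A a]) auto
    moreover have "\<phi> ` c = b" using c(3,4) by (intro equalityI subsetI) auto
    ultimately show "b \<in> con B" using con[OF c(1) ct] by simp
  next
    fix \<alpha>' \<alpha> \<beta> \<beta>' assume h: "(\<alpha>', \<alpha>) \<in> ent A" "(\<alpha>, \<beta>) \<in> \<eta>" "(\<beta>, \<beta>') \<in> ent B"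
    obtain \<gamma> where \<gamma>: "(\<alpha>, \<gamma>) \<in> ent A" "\<beta> = \<phi> \<gamma>" using etaD[OF h(2)] by blast
    obtain \<gamma>' where \<gamma>': "\<gamma>' \<in> tokens A" "\<beta>' = \<phi> \<gamma>'" using is_lis_entD[OF B h(3)] B_token by blast
    have "(\<gamma>, \<gamma>') \<in> ent A" using h(3) \<gamma> \<gamma>' ent[of \<gamma> \<gamma>'] tok[OF \<gamma>(1)] by simp
    then have "(\<alpha>', \<gamma>') \<in> ent A" using tr[OF tr[OF h(1) \<gamma>(1)]] by blast
    then show "(\<alpha>', \<beta>') \<in> \<eta>" using \<gamma>' eta by simp
  qed
  have lin_theta: "linear_approximable B A \<theta>"
    unfolding linear_approximable_def
  proof (intro conjI allI ballI impI theta_sub; elim conjE)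
    fix a b assume a: "a \<in> con B" and b: "finite b" "b \<subseteq> tokens A" "\<forall>\<beta>\<in>b. \<exists>\<alpha>\<in>a. (\<alpha>, \<beta>) \<in> \<theta>"
    have "\<forall>\<beta>\<in>b. \<exists>\<gamma>\<in>{\<gamma>. \<phi> \<gamma> \<in> a}. (\<gamma>, \<beta>) \<in> ent A"
    proof
      fix \<beta> assume "\<beta> \<in> b"
      then obtain \<alpha> where \<alpha>: "\<alpha> \<in> a" "(\<alpha>, \<beta>) \<in> \<theta>" using b(3) by blast
      from thetaD[OF \<alpha>(2)] \<alpha>(1) show "\<exists>\<gamma>\<in>{\<gamma>. \<phi> \<gamma> \<in> a}. (\<gamma>, \<beta>) \<in> ent A" by blast
    qed
    from finite_witnesses[OF b(1) this] obtain c where c: "finite c" "c \<subseteq> {\<gamma>. \<phi> \<gamma> \<in> a}"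
      "\<forall>\<beta>\<in>b. \<exists>\<gamma>\<in>c. (\<gamma>, \<beta>) \<in> ent A" "\<forall>\<gamma>\<in>c. \<exists>\<beta>\<in>b. (\<gamma>, \<beta>) \<in> ent A"
      by (elim exE conjE)
    have ct: "c \<subseteq> tokens A" using c(4) tok by blast
    have cB: "\<phi> ` c \<subseteq> tokens B" using ct surj by blast
    \<comment> \<open>This image is a subset of \<open>a\<close>; subsets of consistent sets are
      consistent because entailment is reflexive.\<close>
    have "\<phi> ` c \<in> con B"
    proof (rule is_lis_conI[OF B a _ cB])
      fix \<beta> assume "\<beta> \<in> \<phi> ` c"
      then have "\<beta> \<in> a" "(\<beta>, \<beta>) \<in> ent B" using c(2) cB is_lis_refl[OF B] by auto
      then show "\<exists>\<alpha>\<in>a. (\<alpha>, \<beta>) \<in> ent B" by blast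
    qed (use c in simp)
    then have "c \<in> con A" using con[OF c(1) ct] by simp
    then show "b \<in> con A" using b(1,2) by (rule is_lis_conI[OF A]) (use c(3) in blast)
  next
    fix \<alpha>' \<alpha> \<beta> \<beta>' assume h: "(\<alpha>', \<alpha>) \<in> ent B" "(\<alpha>, \<beta>) \<in> \<theta>" "(\<beta>, \<beta>') \<in> ent A"
    obtain \<gamma> where \<gamma>: "(\<gamma>, \<beta>) \<in> ent A" "\<alpha> = \<phi> \<gamma>" using thetaD[OF h(2)] by blast
    obtain \<gamma>' where \<gamma>': "\<gamma>' \<in> tokens A" "\<alpha>' = \<phi> \<gamma>'" using is_lis_entD[OF B h(1)] B_token by blast
    have "(\<gamma>', \<gamma>) \<in> ent A" using h(1) \<gamma> \<gamma>' ent[of \<gamma>' \<gamma>] tok[OF \<gamma>(1)] by simp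
    then have "(\<gamma>', \<beta>') \<in> ent A" using tr[OF _ tr[OF \<gamma>(1) h(3)]] by blast
    then show "(\<alpha>', \<beta>') \<in> \<theta>" using \<gamma>' theta by simp
  qed
  have 1: "\<eta> O \<theta> = ent A"
  proof (intro equalityI subrelI)
    fix \<alpha> \<beta> assume "(\<alpha>, \<beta>) \<in> \<eta> O \<theta>"
    then obtain b where b: "(\<alpha>, b) \<in> \<eta>" "(b, \<beta>) \<in> \<theta>" by blast
    obtain \<gamma> where \<gamma>: "(\<alpha>, \<gamma>) \<in> ent A" "b = \<phi> \<gamma>" using etaD[OF b(1)] by blast
    then have "(\<gamma>, \<beta>) \<in> ent A" using b(2) theta tok by simp
    with \<gamma>(1) show "(\<alpha>, \<beta>) \<in> ent A" by (rule tr)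
  next
    fix \<alpha> \<beta> assume h: "(\<alpha>, \<beta>) \<in> ent A"
    then have "\<beta> \<in> tokens A" using tok by blast
    then have "(\<alpha>, \<phi> \<beta>) \<in> \<eta>" "(\<phi> \<beta>, \<beta>) \<in> \<theta>" using h eta theta is_lis_refl[OF A] by auto
    then show "(\<alpha>, \<beta>) \<in> \<eta> O \<theta>" by (rule relcompI)
  qed
  have 2: "\<theta> O \<eta> = ent B"
  proof (intro equalityI subrelI)
    fix a b assume "(a, b) \<in> \<theta> O \<eta>"
    then obtain \<beta> where \<beta>: "(a, \<beta>) \<in> \<theta>" "(\<beta>, b) \<in> \<eta>" by blast
    obtain \<alpha> \<gamma> where *: "(\<alpha>, \<beta>) \<in> ent A" "a = \<phi> \<alpha>" "(\<beta>, \<gamma>) \<in> ent A" "b = \<phi> \<gamma>"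
      using thetaD[OF \<beta>(1)] etaD[OF \<beta>(2)] by blast
    have "(\<alpha>, \<gamma>) \<in> ent A" using tr[OF *(1,3)] .
    then show "(a, b) \<in> ent B" using * tok ent by simp
  next
    fix a b assume h: "(a, b) \<in> ent B"
    then obtain \<alpha> \<beta> where ab: "\<alpha> \<in> tokens A" "\<beta> \<in> tokens A" "a = \<phi> \<alpha>" "b = \<phi> \<beta>"
      using is_lis_entD[OF B h] B_token by blast
    then have "(a, \<beta>) \<in> \<theta>" "(\<beta>, b) \<in> \<eta>" using h ent eta theta is_lis_refl[OF A] by auto
    then show "(a, b) \<in> \<theta> O \<eta>" by (rule relcompI)
  qed
  show ?thesis
    using lin_eta lin_theta 1 2 unfolding \<eta>_def[symmetric] is_iso_def
    by (auto simp: Inf_lin_def intro!: bexI[of _ \<theta>])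
qed


section \<open>The category of prime algebraic domains\<close>

lemma linear_function_compose:
  assumes "partial_order D" "partial_order F" and f: "linear_function D E f" and g: "linear_function E F g"
  shows "linear_function D F (compose (carrier D) g f)"
proof (rule linear_functionI[OF assms(1,2)])
  show "compose (carrier D) g f \<in> carrier D \<rightarrow> carrier F"
    using linear_function_closed[OF f] linear_function_closed[OF g] by (auto simp: compose_eq)
  fix S s assume S: "S \<subseteq> carrier D" and s: "is_lub D S s"
  have "s \<in> carrier D" using s by (simp add: is_lub_iff[OF S])
  moreover have "compose (carrier D) g f ` S = g ` f ` S"
    using S by (auto simp: compose_eq image_iff subset_iff)
  moreover have "f ` S \<subseteq> carrier E" using S linear_function_closed[OF f] by auto
  ultimately show "is_lub F (compose (carrier D) g f ` S) (compose (carrier D) g f s)"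
    using linear_function_lub[OF g _ linear_function_lub[OF f S s]] by (simp add: compose_eq)
qed

lemma linear_function_identity:
  assumes "partial_order D"
  shows "linear_function D D (\<lambda>x\<in>carrier D. x)"
proof (rule linear_function_cong[OF assms assms])
  show "linear_function D D (\<lambda>x. x)" using assms by (rule linear_functionI[OF _ assms]) auto
qed simp

lemma Psd_category: "is_category (Psd small)"
  unfolding is_category_def
proof (intro conjI ballI)
  fix X assume "X \<in> Obj (Psd small)"
  then show "Ident (Psd small) X \<in> Hom (Psd small) X X"
    by (simp add: Psd_def linear_function_identity scott_domain_partial_order)
next
  fix X Y Z f g
  assume "X \<in> Obj (Psd small)" "Y \<in> Obj (Psd small)" "Z \<in> Obj (Psd small)"
    "f \<in> Hom (Psd small) X Y" "g \<in> Hom (Psd small) Y Z"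
  then show "Comp (Psd small) X Y Z g f \<in> Hom (Psd small) X Z"
    using linear_function_compose[of X Z Y f g] by (simp add: Psd_def scott_domain_partial_order)
next
  fix X Y f assume "f \<in> Hom (Psd small) X Y"
  then have f: "f \<in> extensional (carrier X)" "linear_function X Y f" by (auto simp: Psd_def)
  show "Comp (Psd small) X X Y f (Ident (Psd small) X) = f"
    by (rule extensionalityI[of _ "carrier X"]) (use f in \<open>auto simp: Psd_def compose_eq\<close>)
  show "Comp (Psd small) X Y Y (Ident (Psd small) Y) f = f"
    by (rule extensionalityI[of _ "carrier X"])
      (use f linear_function_closed[OF f(2)] in \<open>auto simp: Psd_def compose_eq\<close>)
next
  fix W X Y Z f g h assume "f \<in> Hom (Psd small) W X"
  then have f: "linear_function W X f" by (auto simp: Psd_def)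
  show "Comp (Psd small) W Y Z h (Comp (Psd small) W X Y g f) =
    Comp (Psd small) W X Z (Comp (Psd small) X Y Z h g) f"
    by (rule extensionalityI[of _ "carrier W"])
      (use linear_function_closed[OF f] in \<open>auto simp: Psd_def compose_eq\<close>)
qed

text \<open>An order isomorphism and its inverse both preserve joins. The arrow stated is the
  inverse of \<open>h\<close> because \<open>h\<close> will be the encoding of a domain as points,
  while the counit leads back to the domain.\<close>

lemma Psd_iso_of_order_iso:
  assumes D: "partial_order D" and E: "partial_order E" and h: "bij_betw h (carrier D) (carrier E)"
    and le: "\<And>x y. x \<in> carrier D \<Longrightarrow> y \<in> carrier D \<Longrightarrow> h x \<sqsubseteq>\<^bsub>E\<^esub> h y \<longleftrightarrow> x \<sqsubseteq>\<^bsub>D\<^esub> y"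
  shows "is_iso (Psd small) E D (\<lambda>u\<in>carrier E. inv_into (carrier D) h u)"
proof -
  let ?g = "inv_into (carrier D) h"
  have hc: "h x \<in> carrier E" "?g (h x) = x" if "x \<in> carrier D" for x
    using that h by (auto simp: bij_betw_def)
  have gc: "?g u \<in> carrier D" "h (?g u) = u" if "u \<in> carrier E" for u
    using that h by (auto simp: bij_betw_def inv_into_into f_inv_into_f)
  have "linear_function D E h"
    using hc gc le by (intro linear_function_order_iso[OF D E, where g = ?g]) auto
  then have 1: "linear_function D E (restrict h (carrier D))"
    by (rule linear_function_cong[OF D E]) simp
  have "linear_function E D ?g"
    using hc gc le[OF gc(1) gc(1)] by (intro linear_function_order_iso[OF E D, where g = h]) auto
  then have 2: "linear_function E D (restrict ?g (carrier E))"
    by (rule linear_function_cong[OF E D]) simp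
  have 3: "compose (carrier E) (restrict h (carrier D)) (restrict ?g (carrier E)) = (\<lambda>x\<in>carrier E. x)"
    using gc by (intro ext) (simp add: compose_def restrict_def)
  have 4: "compose (carrier D) (restrict ?g (carrier E)) (restrict h (carrier D)) = (\<lambda>x\<in>carrier D. x)"
    using hc by (intro ext) (simp add: compose_def restrict_def)
  show ?thesis
    unfolding is_iso_def
    by (intro conjI bexI[of _ "restrict h (carrier D)"]) (simp_all add: Psd_def 1 2 3 4)
qed


section \<open>The system of primes\<close>

definition primes_below :: "'a gorder \<Rightarrow> 'a \<Rightarrow> 'a set" where
  "primes_below D d = {p \<in> primes D. p \<sqsubseteq>\<^bsub>D\<^esub> d}"

lemma primes_below_carrier: "primes_below D d \<subseteq> carrier D"
  using primes_subset_carrier[of D] by (auto simp: primes_below_def)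

lemma is_lub_primes_below: "prime_algebraic D \<Longrightarrow> d \<in> carrier D \<Longrightarrow> is_lub D (primes_below D d) d"
  by (simp add: prime_algebraic_def primes_below_def)

text \<open>Entailment is the reversed order, so an upper bound of \<open>a\<close> also bounds
  whatever members of \<open>a\<close> entail.\<close>

lemma minus_lis:
  assumes "partial_order D"
  shows "is_lis (minus_obj D)"
proof -
  interpret partial_order D by (rule assms)
  have pc: "p \<in> carrier D" if "p \<in> primes D" for p using that primes_subset_carrier[of D] by blast
  have "b \<in> con (minus_obj D)"
    if a: "a \<in> con (minus_obj D)" and b: "finite b" "b \<subseteq> tokens (minus_obj D)"
      "\<forall>\<beta>\<in>b. \<exists>\<alpha>\<in>a. (\<alpha>, \<beta>) \<in> ent (minus_obj D)" for a b
  proof -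
    have ap: "a \<subseteq> carrier D" and bp: "b \<subseteq> carrier D" using a b pc by (auto simp: minus_obj_def)
    obtain u where u: "u \<in> carrier D" "\<forall>x\<in>a. x \<sqsubseteq>\<^bsub>D\<^esub> u"
      using a Upper_nonempty_iff[OF ap] by (auto simp: minus_obj_def)
    have "\<forall>x\<in>b. x \<sqsubseteq>\<^bsub>D\<^esub> u"
    proof
      fix x assume "x \<in> b"
      moreover from this obtain y where "y \<in> a" "x \<sqsubseteq>\<^bsub>D\<^esub> y" using b(3) by (auto simp: minus_obj_def)
      ultimately show "x \<sqsubseteq>\<^bsub>D\<^esub> u" using u ap bp le_trans[of x y u] by blast
    qed
    then have "Upper D b \<noteq> {}" using u(1) Upper_nonempty_iff[OF bp] by blast
    then show ?thesis using b by (simp add: minus_obj_def)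
  qed
  moreover have "{p} \<in> con (minus_obj D)" if "p \<in> primes D" for p
    using that pc[OF that] Upper_nonempty_iff[of "{p}" D] by (auto simp: minus_obj_def)
  moreover have "trans (ent (minus_obj D))"
    by (rule transI) (auto simp: minus_obj_def intro: le_trans pc)
  ultimately show ?thesis
    unfolding is_lis_def using pc by (auto simp: minus_obj_def)
qed

context
  fixes D :: "'a gorder"
  assumes D: "scott_domain D" and alg: "prime_algebraic D"
begin

text \<open>By algebraicity \<open>d\<close> is the least bound of the primes below it, and the
  inclusion says that \<open>e\<close> bounds them too.\<close>

lemma primes_below_subset_iff:
  assumes "d \<in> carrier D" "e \<in> carrier D"
  shows "primes_below D d \<subseteq> primes_below D e \<longleftrightarrow> d \<sqsubseteq>\<^bsub>D\<^esub> e"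
proof
  interpret partial_order D using D by (rule scott_domain_partial_order)
  show "d \<sqsubseteq>\<^bsub>D\<^esub> e" if "primes_below D d \<subseteq> primes_below D e"
  proof -
    have "\<forall>p\<in>primes_below D d. p \<sqsubseteq>\<^bsub>D\<^esub> e" using that by (auto simp: primes_below_def)
    then show ?thesis
      using is_lub_primes_below[OF alg assms(1)] assms(2) by (simp add: is_lub_iff[OF primes_below_carrier])
  qed
  show "primes_below D d \<subseteq> primes_below D e" if "d \<sqsubseteq>\<^bsub>D\<^esub> e"
  proof
    fix p assume "p \<in> primes_below D d"
    then show "p \<in> primes_below D e"
      using that assms le_trans[of p d e] primes_subset_carrier[of D] by (auto simp: primes_below_def)
  qed
qed

lemma primes_below_point:
  assumes "d \<in> carrier D"
  shows "primes_below D d \<in> points (minus_obj D)"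
proof -
  interpret partial_order D using D by (rule scott_domain_partial_order)
  have "a \<in> con (minus_obj D)" if "finite a" "a \<subseteq> primes_below D d" for a
  proof -
    have "a \<subseteq> carrier D" using that(2) primes_below_carrier by (rule subset_trans)
    then have "Upper D a \<noteq> {}" using assms that(2) by (auto simp: Upper_nonempty_iff primes_below_def)
    then show ?thesis using that by (auto simp: minus_obj_def primes_below_def)
  qed
  moreover have "p' \<in> primes_below D d" if "p \<in> primes_below D d" "(p, p') \<in> ent (minus_obj D)" for p p'
    using that assms le_trans[of p' p d] primes_subset_carrier[of D]
    by (auto simp: minus_obj_def primes_below_def)
  ultimately show ?thesis by (auto simp: points_def) (auto simp: primes_below_def minus_obj_def)
qed

text \<open>The element sought is the join of \<open>x\<close>, which exists by finite consistency.
  A prime below this join lies below a member of \<open>x\<close>, hence is entailed by it and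
  belongs to \<open>x\<close>: no new primes appear.\<close>

lemma point_eq_primes_below:
  assumes x: "x \<in> points (minus_obj D)"
  shows "\<exists>d\<in>carrier D. primes_below D d = x"
proof -
  have xp: "x \<subseteq> primes D" using x by (auto simp: points_def minus_obj_def)
  then have xc: "x \<subseteq> carrier D" using primes_subset_carrier by (rule subset_trans)
  have "Upper D F \<noteq> {}" if "finite F" "F \<subseteq> x" for F
    using x that by (auto simp: points_def minus_obj_def)
  then obtain s where s: "is_lub D x s" using finitely_bounded_lub_exists[OF D xc] by blast
  then have sc: "s \<in> carrier D" "\<forall>p\<in>x. p \<sqsubseteq>\<^bsub>D\<^esub> s" by (auto simp: is_lub_iff[OF xc])
  have "primes_below D s \<subseteq> x"
  proof
    fix p assume "p \<in> primes_below D s"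
    then have p: "p \<in> primes D" "p \<sqsubseteq>\<^bsub>D\<^esub> s" by (auto simp: primes_below_def)
    then obtain q where q: "q \<in> x" "p \<sqsubseteq>\<^bsub>D\<^esub> q" using prime_le_lubD[OF D xc s] by blast
    then have "(q, p) \<in> ent (minus_obj D)" using p xp by (auto simp: minus_obj_def)
    then show "p \<in> x" using x q(1) unfolding points_def by blast
  qed
  then show ?thesis using sc xp by (auto simp: primes_below_def)
qed

lemma bij_betw_primes_below: "bij_betw (primes_below D) (carrier D) (points (minus_obj D))"
proof -
  interpret partial_order D using D by (rule scott_domain_partial_order)
  have "inj_on (primes_below D) (carrier D)"
    by (rule inj_onI) (metis le_antisym order_refl primes_below_subset_iff)
  then show ?thesis
    using primes_below_point point_eq_primes_below unfolding bij_betw_def by blast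
qed

text \<open>\<open>f d\<close> is the join of the images of the primes below \<open>d\<close>, and a
  prime of \<open>E\<close> below a join lies below a member. Functoriality on composites and
  naturality of the counit both rest on this.\<close>

lemma prime_le_linear_functionD:
  assumes E: "scott_domain E" and f: "linear_function D E f" and d: "d \<in> carrier D"
    and q: "q \<in> primes E" "q \<sqsubseteq>\<^bsub>E\<^esub> f d"
  shows "\<exists>p\<in>primes_below D d. q \<sqsubseteq>\<^bsub>E\<^esub> f p"
proof -
  have lub: "is_lub E (f ` primes_below D d) (f d)"
    using linear_function_lub[OF f primes_below_carrier is_lub_primes_below[OF alg d]] .
  have "f ` primes_below D d \<subseteq> carrier E"
    using linear_function_closed[OF f] primes_below_carrier[of D d] by blast
  from prime_le_lubD[OF E this lub q] show ?thesis by blast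
qed

end


section \<open>The functors\<close>

text \<open>Points are subsets of a small set of tokens, hence small themselves.\<close>

lemma universe_inj_on_points:
  assumes "universe small code" "small (tokens A)"
  shows "inj_on code (points A)"
proof (rule inj_on_subset)
  show "inj_on code {X. small X}" using assms(1) by (simp add: universe_def)
  have "small x" if "x \<subseteq> tokens A" for x using that assms unfolding universe_def by simp
  then show "points A \<subseteq> {X. small X}" by (auto simp: points_def)
qed

lemma Inf_lin_ObjD: "A \<in> Obj (Inf_lin small) \<Longrightarrow> is_lis A \<and> small (tokens A)"
  by (simp add: Inf_lin_def)

lemma Inf_lin_HomD: "R \<in> Hom (Inf_lin small) A B \<Longrightarrow> linear_approximable A B R"
  by (simp add: Inf_lin_def)

lemma Psd_ObjD: "D \<in> Obj (Psd small) \<Longrightarrow> scott_domain D \<and> prime_algebraic D \<and> small (primes D)"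
  by (simp add: Psd_def)

lemma Psd_HomD: "f \<in> Hom (Psd small) D E \<Longrightarrow> f \<in> extensional (carrier D) \<and> linear_function D E f"
  by (simp add: Psd_def)

lemma omap_plus: "omap (plus_functor code) A = plus_obj code A"
  by (simp add: plus_functor_def)

lemma omap_minus: "omap minus_functor D = minus_obj D"
  by (simp add: minus_functor_def)

lemma plus_amap_extensional: "amap (plus_functor code) A B R \<in> extensional (carrier (plus_obj code A))"
  by (simp add: plus_functor_def plus_obj_def)

lemma plus_amap_code:
  assumes "inj_on code (points A)" "x \<in> points A"
  shows "amap (plus_functor code) A B R (code x) = code (rel_plus R x)"
  using assms by (simp add: plus_functor_def)

lemma plus_amap_linear:
  assumes A: "is_lis A" "inj_on code (points A)" and B: "is_lis B" "inj_on code (points B)"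
    and R: "linear_approximable A B R"
  shows "linear_function (plus_obj code A) (plus_obj code B) (amap (plus_functor code) A B R)"
proof (rule linear_functionI[OF plus_partial_order[OF A] plus_partial_order[OF B]])
  note amap = plus_amap_code[OF A(2)] and pt = rel_plus_point[OF A(1) R]
  show "amap (plus_functor code) A B R \<in> carrier (plus_obj code A) \<rightarrow> carrier (plus_obj code B)"
    using amap pt by (auto simp: plus_carrier[OF A] plus_carrier[OF B])
  fix S s assume S: "S \<subseteq> carrier (plus_obj code A)" and s: "is_lub (plus_obj code A) S s"
  obtain X where X: "X \<subseteq> points A" "S = code ` X" by (rule plus_subset_carrierE[OF A S])
  have U: "\<Union>X \<in> points A" "s = code (\<Union>X)" using s plus_is_lub_iff[OF A X(1)] X(2) by auto
  have im: "amap (plus_functor code) A B R ` S = code ` rel_plus R ` X"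
    unfolding X(2) image_image using X(1) amap by (intro image_cong) auto
  have Y: "rel_plus R ` X \<subseteq> points B" using X(1) pt by auto
  show "is_lub (plus_obj code B) (amap (plus_functor code) A B R ` S) (amap (plus_functor code) A B R s)"
    unfolding im plus_is_lub_iff[OF B Y] rel_plus_Union[symmetric]
    using pt[OF U(1)] amap[OF U(1)] U(2) by simp
qed

lemma plus_is_functor:
  assumes U: "universe small code"
  shows "is_functor (Inf_lin small) (Psd small) (plus_functor code)"
  unfolding is_functor_def omap_plus
proof (intro conjI ballI Inf_lin_category Psd_category)
  fix A assume "A \<in> Obj (Inf_lin small)"
  then have A: "is_lis A" "inj_on code (points A)" and sm: "small (tokens A)"
    using Inf_lin_ObjD universe_inj_on_points[OF U] by blast+
  \<comment> \<open>The primes are an image of the tokens, and images of small sets are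
    small.\<close>
  have "small (primes (plus_obj code A))"
    unfolding plus_primes[OF A] using U sm by (simp add: universe_def)
  then show "plus_obj code A \<in> Obj (Psd small)"
    by (simp add: Psd_def plus_scott_domain[OF A] plus_prime_algebraic[OF A])
  show "amap (plus_functor code) A A (Ident (Inf_lin small) A) = Ident (Psd small) (plus_obj code A)"
  proof (rule extensionalityI[OF plus_amap_extensional])
    show "Ident (Psd small) (plus_obj code A) \<in> extensional (carrier (plus_obj code A))"
      by (simp add: Psd_def)
    fix u assume u: "u \<in> carrier (plus_obj code A)"
    then obtain x where "x \<in> points A" "u = code x" by (auto simp: plus_carrier[OF A])
    then show "amap (plus_functor code) A A (Ident (Inf_lin small) A) u = Ident (Psd small) (plus_obj code A) u"
      using u plus_amap_code[OF A(2)] rel_plus_ent[OF A(1)] by (simp add: Psd_def Inf_lin_def)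
  qed
next
  fix A B R assume "A \<in> Obj (Inf_lin small)" "B \<in> Obj (Inf_lin small)" "R \<in> Hom (Inf_lin small) A B"
  then have "linear_function (plus_obj code A) (plus_obj code B) (amap (plus_functor code) A B R)"
    using Inf_lin_ObjD Inf_lin_HomD universe_inj_on_points[OF U] plus_amap_linear by metis
  then show "amap (plus_functor code) A B R \<in> Hom (Psd small) (plus_obj code A) (plus_obj code B)"
    using plus_amap_extensional[of code A B R] by (simp add: Psd_def)
next
  fix A B C R S assume obj: "A \<in> Obj (Inf_lin small)" "B \<in> Obj (Inf_lin small)"
    and hom: "R \<in> Hom (Inf_lin small) A B"
  have A: "is_lis A" "inj_on code (points A)" and B: "inj_on code (points B)"
    using obj Inf_lin_ObjD universe_inj_on_points[OF U] by blast+
  show "amap (plus_functor code) A C (Comp (Inf_lin small) A B C S R) =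
    Comp (Psd small) (plus_obj code A) (plus_obj code B) (plus_obj code C)
      (amap (plus_functor code) B C S) (amap (plus_functor code) A B R)"
  proof (rule extensionalityI[OF plus_amap_extensional])
    fix u assume u: "u \<in> carrier (plus_obj code A)"
    then obtain x where x: "x \<in> points A" "u = code x" by (auto simp: plus_carrier[OF A])
    have "rel_plus R x \<in> points B" using rel_plus_point[OF A(1) Inf_lin_HomD[OF hom] x(1)] .
    then show "amap (plus_functor code) A C (Comp (Inf_lin small) A B C S R) u =
      Comp (Psd small) (plus_obj code A) (plus_obj code B) (plus_obj code C)
        (amap (plus_functor code) B C S) (amap (plus_functor code) A B R) u"
      using u x plus_amap_code[OF A(2)] plus_amap_code[OF B]
      by (simp add: Psd_def Inf_lin_def compose_eq rel_plus_relcomp)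
  qed (simp add: Psd_def)
qed

section \<open>The functor from domains to systems of primes\<close>

lemma minus_amap_iff:
  "(p, q) \<in> amap minus_functor D E f \<longleftrightarrow> p \<in> primes D \<and> q \<in> primes E \<and> q \<sqsubseteq>\<^bsub>E\<^esub> f p"
  by (simp add: minus_functor_def)

text \<open>If \<open>u\<close> bounds \<open>a\<close> then \<open>f u\<close> bounds
  \<open>b\<close>, which is (AR1); (AR2) is monotonicity of \<open>f\<close> together with
  transitivity.\<close>

lemma minus_amap_approximable:
  assumes D: "scott_domain D" and E: "scott_domain E" and f: "linear_function D E f"
  shows "linear_approximable (minus_obj D) (minus_obj E) (amap minus_functor D E f)"
  unfolding linear_approximable_def
proof (intro conjI allI ballI impI; (elim conjE)?)
  interpret E: partial_order E using E by (rule scott_domain_partial_order)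
  have Dc: "p \<in> carrier D" if "p \<in> primes D" for p using that primes_subset_carrier[of D] by blast
  have Ec: "p \<in> carrier E" if "p \<in> primes E" for p using that primes_subset_carrier[of E] by blast
  note fc = linear_function_closed[OF f] and fm = linear_function_mono[OF f]
  show "amap minus_functor D E f \<subseteq> tokens (minus_obj D) \<times> tokens (minus_obj E)"
    by (auto simp: minus_functor_def minus_obj_def)
  {
    fix a b assume a: "a \<in> con (minus_obj D)" and b: "finite b" "b \<subseteq> tokens (minus_obj E)"
      "\<forall>\<beta>\<in>b. \<exists>\<alpha>\<in>a. (\<alpha>, \<beta>) \<in> amap minus_functor D E f"
    have ac: "a \<subseteq> carrier D" and bc: "b \<subseteq> carrier E"
      using a b(2) Dc Ec by (auto simp: minus_obj_def)
    obtain u where u: "u \<in> carrier D" "\<forall>p\<in>a. p \<sqsubseteq>\<^bsub>D\<^esub> u"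
      using a Upper_nonempty_iff[OF ac] by (auto simp: minus_obj_def)
    have "\<forall>q\<in>b. q \<sqsubseteq>\<^bsub>E\<^esub> f u"
    proof
      fix q assume q: "q \<in> b"
      then obtain p where p: "p \<in> a" "q \<sqsubseteq>\<^bsub>E\<^esub> f p" using b(3) unfolding minus_amap_iff by blast
      have pc: "p \<in> carrier D" and qc: "q \<in> carrier E" using p(1) q ac bc by auto
      have "f p \<sqsubseteq>\<^bsub>E\<^esub> f u" using fm[OF pc u(1)] u(2) p(1) by simp
      then show "q \<sqsubseteq>\<^bsub>E\<^esub> f u" using E.le_trans[OF p(2) _ qc fc[OF pc] fc[OF u(1)]] by simp
    qed
    then have "Upper E b \<noteq> {}" using fc[OF u(1)] Upper_nonempty_iff[OF bc] by blast
    then show "b \<in> con (minus_obj E)" using b(1,2) by (simp add: minus_obj_def)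
  next
    fix p' p q q' assume h: "(p', p) \<in> ent (minus_obj D)" "(p, q) \<in> amap minus_functor D E f"
      "(q, q') \<in> ent (minus_obj E)"
    then have *: "p' \<in> primes D" "p \<in> primes D" "q \<in> primes E" "q' \<in> primes E"
      "p \<sqsubseteq>\<^bsub>D\<^esub> p'" "q \<sqsubseteq>\<^bsub>E\<^esub> f p" "q' \<sqsubseteq>\<^bsub>E\<^esub> q"
      by (simp_all add: minus_amap_iff minus_obj_def)
    note p = Dc[OF *(1)] Dc[OF *(2)] and q = Ec[OF *(3)] Ec[OF *(4)]
    have "q' \<sqsubseteq>\<^bsub>E\<^esub> f p" using E.le_trans[OF *(7,6) q(2,1) fc[OF p(2)]] .
    from E.le_trans[OF this fm[OF p(2,1) *(5)] q(2) fc[OF p(2)] fc[OF p(1)]]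
    show "(p', q') \<in> amap minus_functor D E f" using * by (simp add: minus_amap_iff)
  }
qed

lemma minus_is_functor: "is_functor (Psd small) (Inf_lin small) minus_functor"
  unfolding is_functor_def omap_minus
proof (intro conjI ballI Inf_lin_category Psd_category)
  fix D assume "D \<in> Obj (Psd small)"
  then have D: "scott_domain D" "small (primes D)" using Psd_ObjD by blast+
  show "minus_obj D \<in> Obj (Inf_lin small)"
    using minus_lis[OF scott_domain_partial_order[OF D(1)]] D(2)
    by (simp add: Inf_lin_def) (simp add: minus_obj_def)
  have "p \<in> carrier D" if "p \<in> primes D" for p using that primes_subset_carrier[of D] by blast
  then show "amap minus_functor D D (Ident (Psd small) D) = Ident (Inf_lin small) (minus_obj D)"
    by (auto simp: minus_functor_def minus_obj_def Psd_def Inf_lin_def)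
next
  fix D E f assume "D \<in> Obj (Psd small)" "E \<in> Obj (Psd small)" "f \<in> Hom (Psd small) D E"
  then have "linear_approximable (minus_obj D) (minus_obj E) (amap minus_functor D E f)"
    by (intro minus_amap_approximable) (simp_all add: Psd_def)
  then show "amap minus_functor D E f \<in> Hom (Inf_lin small) (minus_obj D) (minus_obj E)"
    by (simp add: Inf_lin_def)
next
  fix D E F f g assume "D \<in> Obj (Psd small)" "E \<in> Obj (Psd small)" "F \<in> Obj (Psd small)"
    "f \<in> Hom (Psd small) D E" "g \<in> Hom (Psd small) E F"
  then have D: "scott_domain D" and E: "scott_domain E" "prime_algebraic E" and F: "scott_domain F"
    and f: "linear_function D E f" and g: "linear_function E F g"
    by (simp_all add: Psd_def)
  interpret F: partial_order F using F by (rule scott_domain_partial_order)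
  have Dc: "p \<in> carrier D" if "p \<in> primes D" for p using that primes_subset_carrier[of D] by blast
  have Ec: "p \<in> carrier E" if "p \<in> primes E" for p using that primes_subset_carrier[of E] by blast
  have Fc: "p \<in> carrier F" if "p \<in> primes F" for p using that primes_subset_carrier[of F] by blast
  have "amap minus_functor D F (compose (carrier D) g f) = amap minus_functor D E f O amap minus_functor E F g"
  proof (intro equalityI subrelI)
    fix p r assume "(p, r) \<in> amap minus_functor D F (compose (carrier D) g f)"
    then have pr: "p \<in> primes D" "r \<in> primes F" "r \<sqsubseteq>\<^bsub>F\<^esub> g (f p)"
      by (auto simp: minus_amap_iff compose_eq Dc)
    \<comment> \<open>Linearity of \<open>g\<close> at \<open>f p\<close> supplies the intermediate
      prime \<open>q\<close> that a relational composite needs.\<close>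
    have "f p \<in> carrier E" using linear_function_closed[OF f Dc[OF pr(1)]] .
    from prime_le_linear_functionD[OF E F g this pr(2,3)]
    obtain q where "q \<in> primes E" "q \<sqsubseteq>\<^bsub>E\<^esub> f p" "r \<sqsubseteq>\<^bsub>F\<^esub> g q" by (auto simp: primes_below_def)
    then show "(p, r) \<in> amap minus_functor D E f O amap minus_functor E F g"
      using pr by (intro relcompI[of p q]) (simp_all add: minus_amap_iff)
  next
    fix p r assume "(p, r) \<in> amap minus_functor D E f O amap minus_functor E F g"
    then obtain q where q: "(p, q) \<in> amap minus_functor D E f" "(q, r) \<in> amap minus_functor E F g" by blast
    then have *: "p \<in> primes D" "q \<in> primes E" "r \<in> primes F" "q \<sqsubseteq>\<^bsub>E\<^esub> f p" "r \<sqsubseteq>\<^bsub>F\<^esub> g q"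
      by (simp_all add: minus_amap_iff)
    have fp: "f p \<in> carrier E" using linear_function_closed[OF f Dc[OF *(1)]] .
    have "g q \<sqsubseteq>\<^bsub>F\<^esub> g (f p)" using linear_function_mono[OF g Ec[OF *(2)] fp *(4)] .
    from F.le_trans[OF *(5) this Fc[OF *(3)] linear_function_closed[OF g Ec[OF *(2)]] linear_function_closed[OF g fp]]
    show "(p, r) \<in> amap minus_functor D F (compose (carrier D) g f)"
      using * by (simp add: minus_amap_iff compose_eq Dc)
  qed
  then show "amap minus_functor D F (Comp (Psd small) D E F g f) =
    Comp (Inf_lin small) (minus_obj D) (minus_obj E) (minus_obj F)
      (amap minus_functor E F g) (amap minus_functor D E f)"
    by (simp add: Psd_def Inf_lin_def)
qed


section \<open>The natural isomorphisms\<close>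

text \<open>A consistent set thus extends to a point without any bounding point being given, so
  consistency in \<open>A\<close> implies boundedness among the points.\<close>

lemma Union_token_closure_point:
  assumes A: "is_lis A" and a: "a \<in> con A"
  shows "\<Union>(token_closure A ` a) \<in> points A"
proof -
  have sub: "\<Union>(token_closure A ` a) \<subseteq> tokens A" using is_lis_entD[OF A] by (auto simp: token_closure_def)
  have "b \<in> con A" if "finite b" "b \<subseteq> \<Union>(token_closure A ` a)" for b
  proof (rule is_lis_conI[OF A a that(1)])
    show "b \<subseteq> tokens A" using that(2) sub by blast
    show "\<exists>\<alpha>\<in>a. (\<alpha>, \<beta>) \<in> ent A" if "\<beta> \<in> b" for \<beta>
      using \<open>b \<subseteq> \<Union>(token_closure A ` a)\<close> that by (auto simp: token_closure_def)
  qed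
  moreover have "\<beta>' \<in> \<Union>(token_closure A ` a)" if "\<beta> \<in> \<Union>(token_closure A ` a)" "(\<beta>, \<beta>') \<in> ent A" for \<beta> \<beta>'
    using that is_lis_trans[OF A _ that(2)] by (auto simp: token_closure_def)
  ultimately show ?thesis using sub unfolding points_def by blast
qed

text \<open>The plain graph of the map from tokens to primes would violate (AR2); saturating it
  under entailment repairs this.\<close>

definition unit_rel :: "('u set \<Rightarrow> 'u) \<Rightarrow> 'u lis \<Rightarrow> ('u \<times> 'u) set" where
  "unit_rel code A = {(\<alpha>, code (token_closure A \<alpha>')) |\<alpha> \<alpha>'. (\<alpha>, \<alpha>') \<in> ent A}"

lemma unit_rel_iso:
  assumes A: "is_lis A" "inj_on code (points A)"
  shows "is_iso (Inf_lin small) A (minus_obj (plus_obj code A)) (unit_rel code A)"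
  unfolding unit_rel_def
proof (rule lis_iso_of_surjection[OF A(1)])
  let ?P = "plus_obj code A" and ?\<phi> = "\<lambda>\<alpha>. code (token_closure A \<alpha>)"
  show "is_lis (minus_obj ?P)" by (rule minus_lis[OF plus_partial_order[OF A]])
  show "?\<phi> ` tokens A = tokens (minus_obj ?P)" by (simp add: minus_obj_def plus_primes[OF A])
  note pt = token_closure_point[OF A(1)] and sub = token_closure_subset[OF A(1)]
  have le: "?\<phi> \<alpha> \<sqsubseteq>\<^bsub>?P\<^esub> code x \<longleftrightarrow> \<alpha> \<in> x" if "\<alpha> \<in> tokens A" "x \<in> points A" for \<alpha> x
    using plus_le_iff[OF A pt[OF that(1)] that(2)] sub[OF that(2,1)] by simp
  show "(?\<phi> \<alpha>, ?\<phi> \<beta>) \<in> ent (minus_obj ?P) \<longleftrightarrow> (\<alpha>, \<beta>) \<in> ent A"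
    if "\<alpha> \<in> tokens A" "\<beta> \<in> tokens A" for \<alpha> \<beta>
    using that le[OF that(2) pt[OF that(1)]] by (simp add: minus_obj_def plus_primes[OF A] token_closure_def)
  show "?\<phi> ` a \<in> con (minus_obj ?P) \<longleftrightarrow> a \<in> con A" if a: "finite a" "a \<subseteq> tokens A" for a
  proof -
    have pr: "?\<phi> ` a \<subseteq> primes ?P" using a(2) unfolding plus_primes[OF A] by blast
    then have "?\<phi> ` a \<subseteq> carrier ?P" using primes_subset_carrier by (rule subset_trans)
    \<comment> \<open>Bounded means contained in a point, and for a finite set of tokens this means
      consistent. For \<open>a = {}\<close> it compares existence of a point with
      \<open>{} \<in> con A\<close>, which covers the system without points.\<close>
    then have "Upper ?P (?\<phi> ` a) \<noteq> {} \<longleftrightarrow> (\<exists>x\<in>points A. \<forall>\<alpha>\<in>a. ?\<phi> \<alpha> \<sqsubseteq>\<^bsub>?P\<^esub> code x)"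
      by (simp add: Upper_nonempty_iff plus_carrier[OF A])
    also have "\<dots> \<longleftrightarrow> (\<exists>x\<in>points A. a \<subseteq> x)"
    proof (rule bex_cong[OF refl])
      fix x assume x: "x \<in> points A"
      show "(\<forall>\<alpha>\<in>a. ?\<phi> \<alpha> \<sqsubseteq>\<^bsub>?P\<^esub> code x) \<longleftrightarrow> a \<subseteq> x"
        using le[OF _ x] a(2) by (simp add: subset_iff Ball_def)
    qed
    also have "\<dots> \<longleftrightarrow> a \<in> con A"
    proof
      assume "\<exists>x\<in>points A. a \<subseteq> x"
      then show "a \<in> con A" using a(1) by (auto simp: points_def)
    next
      assume "a \<in> con A"
      moreover have "a \<subseteq> \<Union>(token_closure A ` a)" using a(2) token_closure_refl[OF A(1)] by blast
      ultimately show "\<exists>x\<in>points A. a \<subseteq> x" using Union_token_closure_point[OF A(1)] by blast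
    qed
    finally show ?thesis using a(1) pr by (simp add: minus_obj_def)
  qed
qed

text \<open>Going to domains and back returns \<open>R\<close>, with tokens replaced by primes:
  evaluating at the closure of \<open>\<alpha>\<close> composes \<open>R\<close> with entailment,
  which \<open>R\<close> absorbs.\<close>

lemma minus_plus_amap_iff:
  assumes A: "is_lis A" "inj_on code (points A)" and B: "is_lis B" "inj_on code (points B)"
    and R: "linear_approximable A B R" and \<alpha>: "\<alpha> \<in> tokens A" and \<beta>: "\<beta> \<in> tokens B"
  shows "(code (token_closure A \<alpha>), code (token_closure B \<beta>)) \<in>
    amap minus_functor (plus_obj code A) (plus_obj code B) (amap (plus_functor code) A B R) \<longleftrightarrow> (\<alpha>, \<beta>) \<in> R"
proof -
  note pt\<alpha> = token_closure_point[OF A(1) \<alpha>] and pt\<beta> = token_closure_point[OF B(1) \<beta>]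
  note ptR = rel_plus_point[OF A(1) R pt\<alpha>]
  have "\<beta> \<in> rel_plus R (token_closure A \<alpha>) \<longleftrightarrow> (\<alpha>, \<beta>) \<in> ent A O R"
    by (auto simp: rel_plus_def token_closure_def)
  also have "\<dots> \<longleftrightarrow> (\<alpha>, \<beta>) \<in> R" by (simp add: ent_relcomp(1)[OF A(1) B(1) R])
  finally show ?thesis
    using \<alpha> \<beta> plus_le_iff[OF B pt\<beta> ptR] token_closure_subset[OF B(1) ptR \<beta>]
    by (simp add: minus_amap_iff plus_primes[OF A] plus_primes[OF B] plus_amap_code[OF A(2) pt\<alpha>])
qed

text \<open>Absorbing the entailments, both sides relate \<open>\<alpha>\<close> to the code of the
  closure of \<open>\<beta>\<close> for those \<open>\<beta>\<close> with
  \<open>(\<alpha>, \<beta>) \<in> R\<close>.\<close>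

lemma unit_rel_natural:
  assumes A: "is_lis A" "inj_on code (points A)" and B: "is_lis B" "inj_on code (points B)"
    and R: "linear_approximable A B R"
  shows "R O unit_rel code B =
    unit_rel code A O amap minus_functor (plus_obj code A) (plus_obj code B) (amap (plus_functor code) A B R)"
    (is "_ = _ O ?M")
proof (intro equalityI subrelI)
  note M = minus_plus_amap_iff[OF A B R]
  fix \<alpha> b assume "(\<alpha>, b) \<in> R O unit_rel code B"
  then obtain \<beta> \<beta>' where \<beta>: "(\<alpha>, \<beta>) \<in> R" "(\<beta>, \<beta>') \<in> ent B" "b = code (token_closure B \<beta>')"
    by (auto simp: unit_rel_def)
  then have "(\<alpha>, \<beta>') \<in> R" using ent_relcomp(2)[OF A(1) B(1) R] by blast
  moreover from this have t: "\<alpha> \<in> tokens A" "\<beta>' \<in> tokens B" using linear_approximable_subset[OF R] by auto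
  ultimately have "(code (token_closure A \<alpha>), b) \<in> ?M" using M \<beta>(3) by simp
  moreover have "(\<alpha>, code (token_closure A \<alpha>)) \<in> unit_rel code A"
    using is_lis_refl[OF A(1) t(1)] by (auto simp: unit_rel_def)
  ultimately show "(\<alpha>, b) \<in> unit_rel code A O ?M" by blast
next
  note M = minus_plus_amap_iff[OF A B R]
  fix \<alpha> b assume "(\<alpha>, b) \<in> unit_rel code A O ?M"
  then obtain \<alpha>' where \<alpha>': "(\<alpha>, \<alpha>') \<in> ent A" "(code (token_closure A \<alpha>'), b) \<in> ?M"
    by (auto simp: unit_rel_def)
  then have "b \<in> primes (plus_obj code B)" by (simp add: minus_amap_iff)
  then obtain \<beta> where \<beta>: "\<beta> \<in> tokens B" "b = code (token_closure B \<beta>)" by (auto simp: plus_primes[OF B])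
  have "\<alpha>' \<in> tokens A" using is_lis_entD[OF A(1) \<alpha>'(1)] by simp
  then have "(\<alpha>', \<beta>) \<in> R" using M \<alpha>'(2) \<beta> by simp
  then have "(\<alpha>, \<beta>) \<in> R" using \<alpha>'(1) ent_relcomp(1)[OF A(1) B(1) R] by blast
  moreover have "(\<beta>, b) \<in> unit_rel code B" using is_lis_refl[OF B(1) \<beta>(1)] \<beta>(2) by (auto simp: unit_rel_def)
  ultimately show "(\<alpha>, b) \<in> R O unit_rel code B" by blast
qed

text \<open>Decodes a point of the system of primes to the element having exactly these primes below
  it, which is their join.\<close>

definition counit_fun :: "('u set \<Rightarrow> 'u) \<Rightarrow> 'u gorder \<Rightarrow> 'u \<Rightarrow> 'u" where
  "counit_fun code D = (\<lambda>u\<in>carrier (plus_obj code (minus_obj D)).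
     inv_into (carrier D) (\<lambda>d. code (primes_below D d)) u)"

context
  fixes D :: "'u gorder" and code :: "'u set \<Rightarrow> 'u"
  assumes D: "scott_domain D" and alg: "prime_algebraic D"
    and inj: "inj_on code (points (minus_obj D))"
begin

lemma code_primes_below_bij:
  "bij_betw (\<lambda>d. code (primes_below D d)) (carrier D) (carrier (plus_obj code (minus_obj D)))"
proof -
  have "bij_betw code (points (minus_obj D)) (carrier (plus_obj code (minus_obj D)))"
    using inj by (simp add: bij_betw_def plus_obj_def)
  from bij_betw_trans[OF bij_betw_primes_below[OF D alg] this] show ?thesis by (simp add: comp_def)
qed

lemma counit_fun_code: "d \<in> carrier D \<Longrightarrow> counit_fun code D (code (primes_below D d)) = d"
  using bij_betw_apply[OF code_primes_below_bij]
    inv_into_f_f[OF bij_betw_imp_inj_on[OF code_primes_below_bij]]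
  by (simp add: counit_fun_def)

lemma counit_fun_iso: "is_iso (Psd small) (plus_obj code (minus_obj D)) D (counit_fun code D)"
  unfolding counit_fun_def
proof (rule Psd_iso_of_order_iso[OF scott_domain_partial_order[OF D] _ code_primes_below_bij])
  note lis = minus_lis[OF scott_domain_partial_order[OF D]]
  show "partial_order (plus_obj code (minus_obj D))" by (rule plus_partial_order[OF lis inj])
  show "code (primes_below D d) \<sqsubseteq>\<^bsub>plus_obj code (minus_obj D)\<^esub> code (primes_below D e) \<longleftrightarrow> d \<sqsubseteq>\<^bsub>D\<^esub> e"
    if "d \<in> carrier D" "e \<in> carrier D" for d e
    using plus_le_iff[OF lis inj primes_below_point[OF D alg] primes_below_point[OF D alg]]
      primes_below_subset_iff[OF D alg] that by simp
qed

end

text \<open>Naturality of the counit before encoding. One inclusion is monotonicity of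
  \<open>f\<close>; the other needs linearity, which provides a prime below
  \<open>d\<close>.\<close>

lemma rel_plus_minus_amap:
  assumes D: "scott_domain D" "prime_algebraic D" and E: "scott_domain E" and f: "linear_function D E f"
    and d: "d \<in> carrier D"
  shows "rel_plus (amap minus_functor D E f) (primes_below D d) = primes_below E (f d)"
proof (intro equalityI subsetI)
  interpret E: partial_order E using E by (rule scott_domain_partial_order)
  fix q assume "q \<in> rel_plus (amap minus_functor D E f) (primes_below D d)"
  then obtain p where p: "p \<in> primes D" "p \<sqsubseteq>\<^bsub>D\<^esub> d" "q \<in> primes E" "q \<sqsubseteq>\<^bsub>E\<^esub> f p"
    by (auto simp: rel_plus_def minus_amap_iff primes_below_def)
  have pc: "p \<in> carrier D" and qc: "q \<in> carrier E"
    using p primes_subset_carrier[of D] primes_subset_carrier[of E] by auto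
  note fc = linear_function_closed[OF f]
  from E.le_trans[OF p(4) linear_function_mono[OF f pc d p(2)] qc fc[OF pc] fc[OF d]]
  show "q \<in> primes_below E (f d)" using p(3) by (simp add: primes_below_def)
next
  fix q assume "q \<in> primes_below E (f d)"
  then have q: "q \<in> primes E" "q \<sqsubseteq>\<^bsub>E\<^esub> f d" by (simp_all add: primes_below_def)
  from prime_le_linear_functionD[OF D E f d q]
  show "q \<in> rel_plus (amap minus_functor D E f) (primes_below D d)"
    using q(1) by (auto simp: rel_plus_def minus_amap_iff primes_below_def)
qed

text \<open>Every \<open>u\<close> in the source encodes the primes below some \<open>d\<close>, and
  both composites send it to \<open>f d\<close>.\<close>

lemma counit_fun_natural:
  assumes D: "scott_domain D" "prime_algebraic D" "inj_on code (points (minus_obj D))"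
    and E: "scott_domain E" "prime_algebraic E" "inj_on code (points (minus_obj E))"
    and f: "linear_function D E f"
  shows "compose (carrier (plus_obj code (minus_obj D))) (counit_fun code E)
      (amap (plus_functor code) (minus_obj D) (minus_obj E) (amap minus_functor D E f)) =
    compose (carrier (plus_obj code (minus_obj D))) f (counit_fun code D)"
    (is "compose ?C _ ?M = _")
proof (rule extensionalityI[of _ ?C])
  fix u assume u: "u \<in> ?C"
  then obtain d where d: "d \<in> carrier D" "u = code (primes_below D d)"
    using code_primes_below_bij[OF D] by (auto simp: bij_betw_def)
  have "?M u = code (primes_below E (f d))"
    using d plus_amap_code[OF D(3) primes_below_point[OF D(1,2) d(1)]] rel_plus_minus_amap[OF D(1,2) E(1) f d(1)]
    by simp
  then show "compose ?C (counit_fun code E) ?M u = compose ?C f (counit_fun code D) u"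
    using u d(2) counit_fun_code[OF D d(1)] counit_fun_code[OF E linear_function_closed[OF f d(1)]]
    by (simp add: compose_eq)
qed simp_all

theorem mainTheorem4:
  fixes small :: "'u set \<Rightarrow> bool" and code :: "'u set \<Rightarrow> 'u"
  assumes "universe small code"
  shows "is_functor (Inf_lin small) (Psd small) (plus_functor code) \<and>
         is_functor (Psd small) (Inf_lin small) minus_functor \<and>
         cat_equivalence (Inf_lin small) (Psd small) (plus_functor code) minus_functor"
proof -
  note F = plus_is_functor[OF assms] and G = minus_is_functor[of small]
  have lis: "is_lis A \<and> inj_on code (points A)" if "A \<in> Obj (Inf_lin small)" for A
    using Inf_lin_ObjD[OF that] universe_inj_on_points[OF assms] by blast
  \<comment> \<open>Smallness in \<open>Psd\<close> is imposed on the primes because they are the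
    tokens of \<open>minus_obj D\<close>, whose points must be encoded.\<close>
  have psd: "scott_domain D \<and> prime_algebraic D \<and> inj_on code (points (minus_obj D))"
    if "D \<in> Obj (Psd small)" for D
    using Psd_ObjD[OF that] universe_inj_on_points[OF assms, of "minus_obj D"] by (simp add: minus_obj_def)
  have "natural_iso (Inf_lin small) (Inf_lin small) id_functor
    (comp_functor minus_functor (plus_functor code)) (unit_rel code)"
    unfolding natural_iso_def
  proof (intro conjI ballI)
    fix A assume "A \<in> Obj (Inf_lin small)"
    then show "is_iso (Inf_lin small) (omap id_functor A)
      (omap (comp_functor minus_functor (plus_functor code)) A) (unit_rel code A)"
      using unit_rel_iso[of A code small] lis by (simp add: id_functor_def comp_functor_def omap_plus omap_minus)
  next
    fix A B R assume "A \<in> Obj (Inf_lin small)" "B \<in> Obj (Inf_lin small)" "R \<in> Hom (Inf_lin small) A B"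
    then have "R O unit_rel code B = unit_rel code A O
        amap minus_functor (plus_obj code A) (plus_obj code B) (amap (plus_functor code) A B R)"
      using lis[of A] lis[of B] Inf_lin_HomD by (intro unit_rel_natural) simp_all
    then show "Comp (Inf_lin small) (omap id_functor A) (omap id_functor B)
        (omap (comp_functor minus_functor (plus_functor code)) B) (unit_rel code B) (amap id_functor A B R) =
      Comp (Inf_lin small) (omap id_functor A) (omap (comp_functor minus_functor (plus_functor code)) A)
        (omap (comp_functor minus_functor (plus_functor code)) B)
        (amap (comp_functor minus_functor (plus_functor code)) A B R) (unit_rel code A)"
      by (simp add: id_functor_def comp_functor_def omap_plus Inf_lin_def)
  qed
  moreover have "natural_iso (Psd small) (Psd small) (comp_functor (plus_functor code) minus_functor)
    id_functor (counit_fun code)"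
    unfolding natural_iso_def
  proof (intro conjI ballI)
    fix D assume "D \<in> Obj (Psd small)"
    then show "is_iso (Psd small) (omap (comp_functor (plus_functor code) minus_functor) D)
      (omap id_functor D) (counit_fun code D)"
      using counit_fun_iso[of D code small] psd by (simp add: id_functor_def comp_functor_def omap_plus omap_minus)
  next
    fix D E f assume "D \<in> Obj (Psd small)" "E \<in> Obj (Psd small)" "f \<in> Hom (Psd small) D E"
    then have "compose (carrier (plus_obj code (minus_obj D))) (counit_fun code E)
        (amap (plus_functor code) (minus_obj D) (minus_obj E) (amap minus_functor D E f)) =
      compose (carrier (plus_obj code (minus_obj D))) f (counit_fun code D)"
      using psd[of D] psd[of E] Psd_HomD[of f] by (intro counit_fun_natural) simp_all
    then show "Comp (Psd small) (omap (comp_functor (plus_functor code) minus_functor) D)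
        (omap (comp_functor (plus_functor code) minus_functor) E) (omap id_functor E) (counit_fun code E)
        (amap (comp_functor (plus_functor code) minus_functor) D E f) =
      Comp (Psd small) (omap (comp_functor (plus_functor code) minus_functor) D) (omap id_functor D)
        (omap id_functor E) (amap id_functor D E f) (counit_fun code D)"
      by (simp add: id_functor_def comp_functor_def omap_plus omap_minus Psd_def)
  qed
  ultimately show ?thesis using F G unfolding cat_equivalence_def by blast
qed

end
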